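(* There exist an entire function $f:\mathbb{C}\to\mathbb{C}$ and an invariant Baker domain $U$ of $f$ such that $U$ is simply parabolic and the restriction $f|_U$ is not univalent (that is, not injective).
   Context: Let $f$ be an entire function. The Fatou set $\mathcal{F}(f)$ is the subset of $\mathbb{C}$ where the iterates $f^n$ of $f$ form a normal family (in the sense of Montel, with limits allowed to be $\infty$). Its connected components are called Fatou components. A Baker domain of a (transcendental) entire function $f$ is a periodic Fatou component $U$ such that $f^n|_U\to\infty$ locally uniformly as $n\to\infty$. It is invariant if $f(U)\subset U$. Baker domains of entire functions are known to be simply connected, and $f$ has no fixed point in a Baker domain. Classification. Let $U\subsetneq\mathbb{C}$ be a simply connected domain and $f:U\to U$ holomorphic without fixed point in $U$ (for example, $U$ an invariant Baker domain of $f$). Call $u,v\in U$ equivalent if $f^m(u)=f^n(v)$ for some $m,n\in\mathbb{N}$, and let $U/f$ be the set of equivalence classes. It is known that $U/f$ is a Riemann surface conformally equivalent to exactly one of the following: (a) $\{z\in\mathbb{C}:-s<\operatorname{Im} z<s\}/\mathbb{Z}$ for some $s>0$; (b) $\{z\in\mathbb{C}:\operatorname{Im} z>0\}/\mathbb{Z}$; (c) $\mathbb{C}/\mathbb{Z}$. One calls $U$ (or $f:U\to U$) hyperbolic in case (a), simply parabolic in case (b), doubly parabolic in case (c). Equivalent description of the types. Let $\mathbb{H}=\{z\in\mathbb{C}:\operatorname{Re} z>0\}$. A subdomain $V\subset U$ is absorbing for $f:U\to U$ if $V$ is simply connected, $f(V)\subset V$, and for every compact $K\subset U$ there is $n=n(K)$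 with $f^n(K)\subset V$. An eventual conjugacy of $f$ in $U$ is a tuple $(V,\varphi,T,\Omega)$ such that $V$ is absorbing for $f$; $\varphi:U\to\Omega\in\{\mathbb{H},\mathbb{C}\}$ is holomorphic, and univalent in $V$; $T$ is a Möbius transformation mapping $\Omega$ onto itself and $\varphi(V)$ is absorbing for $T:\Omega\to\Omega$; and $\varphi(f(z))=T(\varphi(z))$ for all $z\in U$. It is known that there is an eventual conjugacy in which $(\Omega,T)$ is of exactly one of the following forms: (a) $\Omega=\mathbb{H}$, $T(z)=\lambda z$ with $\lambda>1$; (b) $\Omega=\mathbb{H}$, $T(z)=z+i$ or $T(z)=z-i$; (c) $\Omega=\mathbb{C}$, $T(z)=z+1$. These cases correspond precisely to hyperbolic, simply parabolic and doubly parabolic, respectively. *)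

theory Defs
  imports "HOL-Complex_Analysis.Complex_Analysis"
begin

definition tends_to_infinity_locally_uniformly ::
  "(nat \<Rightarrow> complex \<Rightarrow> complex) \<Rightarrow> complex set \<Rightarrow> bool" where
  "tends_to_infinity_locally_uniformly s W \<longleftrightarrow>
     (\<forall>K. compact K \<and> K \<subseteq> W \<longrightarrow>
        (\<forall>B::real. \<forall>\<^sub>F n in sequentially. \<forall>z\<in>K. B < norm (s n z)))"

text \<open>Normality on a domain \<open>W\<close> in the sense of Montel, for families of holomorphic functions.
  On a connected open set a locally uniform limit in the spherical metric is either
  holomorphic or identically infinite, which gives the two alternatives below.\<close>

definition normal_family_on ::
  "(complex \<Rightarrow> complex) set \<Rightarrow> complex set \<Rightarrow> bool" where
  "normal_family_on \<F> W \<longleftrightarrow>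
     (\<forall>s :: nat \<Rightarrow> complex \<Rightarrow> complex. range s \<subseteq> \<F> \<longrightarrow>
        (\<exists>r :: nat \<Rightarrow> nat. strict_mono r \<and>
           ((\<exists>g. g holomorphic_on W \<and>
               (\<forall>K. compact K \<and> K \<subseteq> W \<longrightarrow> uniform_limit K (s \<circ> r) g sequentially))
            \<or> tends_to_infinity_locally_uniformly (s \<circ> r) W)))"

definition fatou_set :: "(complex \<Rightarrow> complex) \<Rightarrow> complex set" where
  "fatou_set f =
     {z. \<exists>W. open W \<and> connected W \<and> z \<in> W \<and> normal_family_on (range (\<lambda>n. f ^^ n)) W}"

definition transcendental_entire :: "(complex \<Rightarrow> complex) \<Rightarrow> bool" where
  "transcendental_entire f \<longleftrightarrow> f holomorphic_on UNIV \<and> \<not> (\<exists>p. f = poly p)"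

definition baker_domain :: "(complex \<Rightarrow> complex) \<Rightarrow> complex set \<Rightarrow> bool" where
  "baker_domain f U \<longleftrightarrow>
     transcendental_entire f \<and>
     U \<in> components (fatou_set f) \<and>
     (\<exists>p\<ge>1. (f ^^ p) ` U \<subseteq> U) \<and>
     tends_to_infinity_locally_uniformly (\<lambda>n. f ^^ n) U"

definition invariant_baker_domain :: "(complex \<Rightarrow> complex) \<Rightarrow> complex set \<Rightarrow> bool" where
  "invariant_baker_domain f U \<longleftrightarrow> baker_domain f U \<and> f ` U \<subseteq> U"

text \<open>For an equivalence relation \<open>R\<close> on an open set \<open>U\<close>, the quotient \<open>U // R\<close> carries the
  quotient topology (a set \<open>W\<close> of classes is open iff its preimage \<open>\<Union>W\<close> in \<open>U\<close> is open) and the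
  quotient complex structure (a function on \<open>W\<close> is holomorphic iff its composition with the
  projection is holomorphic on \<open>\<Union>W\<close>). Whenever the quotient is a Riemann surface with
  nonconstant holomorphic projection, these are its open sets and its holomorphic functions.\<close>

definition quotient_holomorphic_on ::
  "complex set \<Rightarrow> (complex \<times> complex) set \<Rightarrow> complex set set \<Rightarrow> (complex set \<Rightarrow> complex) \<Rightarrow> bool"
  where
  "quotient_holomorphic_on U R W h \<longleftrightarrow>
     W \<subseteq> U // R \<and> open (\<Union>W) \<and> (\<lambda>z. h (R `` {z})) holomorphic_on \<Union>W"

text \<open>A conformal equivalence is a bijection identifying the open sets and the holomorphic
  functions on them; the case of constant \<open>h\<close> says that \<open>\<Phi>\<close> is a homeomorphism.\<close>

definition conformally_equivalent_quotients ::
  "complex set \<Rightarrow> (complex \<times> complex) set \<Rightarrow> complex set \<Rightarrow> (complex \<times> complex) set \<Rightarrow> bool"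
  where
  "conformally_equivalent_quotients U R V S \<longleftrightarrow>
     (\<exists>\<Phi>. bij_betw \<Phi> (U // R) (V // S) \<and>
        (\<forall>W h. W \<subseteq> V // S \<longrightarrow>
           (quotient_holomorphic_on V S W h \<longleftrightarrow>
            quotient_holomorphic_on U R {c \<in> U // R. \<Phi> c \<in> W} (h \<circ> \<Phi>))))"

definition grand_orbit_rel ::
  "(complex \<Rightarrow> complex) \<Rightarrow> complex set \<Rightarrow> (complex \<times> complex) set" where
  "grand_orbit_rel f U = {(u, v). u \<in> U \<and> v \<in> U \<and> (\<exists>m n. (f ^^ m) u = (f ^^ n) v)}"

definition integer_translation_rel :: "complex set \<Rightarrow> (complex \<times> complex) set" where
  "integer_translation_rel V = {(z, w). z \<in> V \<and> w \<in> V \<and> w - z \<in> \<int>}"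

text \<open>Meaningful for a simply connected proper subdomain \<open>U\<close> and a holomorphic self-map of \<open>U\<close>
  without fixed point, in particular for every invariant Baker domain: \<open>U/f\<close> is conformally
  equivalent to the upper half-plane modulo \<open>\<int>\<close>.\<close>

definition simply_parabolic :: "(complex \<Rightarrow> complex) \<Rightarrow> complex set \<Rightarrow> bool" where
  "simply_parabolic f U \<longleftrightarrow>
     conformally_equivalent_quotients
       U (grand_orbit_rel f U)
       {z. 0 < Im z} (integer_translation_rel {z. 0 < Im z})"

end

theory Submission
  imports Defs
begin

text \<open>
  The example is \<open>f z = z + a (1 - exp (2 \<pi> \<i> z\<^sup>2))\<close> for one real number \<open>a \<ge> 3\<close>. Two features of the
  factor \<open>w z = exp (2 \<pi> \<i> z\<^sup>2)\<close> carry the proof: it equals 1 at every integer, so that \<open>f\<close> fixes all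
  integers, and \<open>norm (w z) = exp (- 4 \<pi> Re z Im z)\<close> is tiny in the first quadrant and huge in the
  fourth one.

  On a quadrant \<open>{Re z > X, Im z > \<delta>}\<close> with \<open>X\<close> large in terms of \<open>\<delta>\<close>, the map is a small
  perturbation of \<open>z \<mapsto> z + a\<close>, and the differences \<open>f\<^sup>n z - n a\<close> form a Cauchy sequence, the successive
  errors being dominated by a geometric series (\<open>orbit_estimate\<close>). Hence these quadrants lie in
  the Fatou set. Let \<open>U\<close> be the Fatou component containing them. On a domain of normality that
  contains a point escaping to infinity no orbit ever hits an integer, because integers are fixed.
  So \<open>f\<^sup>n\<close> minus the integer part of \<open>n a\<close> omits 0 and 1, and Schottky's theorem propagates
  local boundedness of \<open>f\<^sup>n z - n a\<close> from the quadrants to all of \<open>U\<close>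
  (\<open>fatou_component_subset_drift_set\<close>). In particular \<open>f\<^sup>n\<close> tends to infinity locally uniformly on
  \<open>U\<close>, and by Vitali's theorem \<open>\<phi> = lim (f\<^sup>n - n a)\<close> exists and is holomorphic on \<open>U\<close>, with
  \<open>\<phi> (f z) = \<phi> z + a\<close>.

  The values of \<open>\<phi>\<close> lie in the upper half-plane: since \<open>a w (f\<^sup>n z) = (f\<^sup>n z - n a) - (f\<^sup>n\<^sup>+\<^sup>1 z - (n + 1) a)\<close> tends to 0 on
  \<open>U\<close> and \<open>Re (f\<^sup>n z)\<close> tends to infinity, the imaginary part of \<open>f\<^sup>n z\<close> is eventually positive, so
  \<open>Im \<phi> \<ge> 0\<close>, and \<open>Im \<phi> > 0\<close> by the open mapping theorem. Thus every orbit in \<open>U\<close> ends up in the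
  quadrants, where \<open>\<phi>\<close> is close to the identity. Consequently \<open>\<phi> u = \<phi> v\<close> holds only if the orbits
  of \<open>u\<close> and \<open>v\<close> merge, and \<open>\<phi>\<close> has local holomorphic sections over every point of the upper
  half-plane, up to translation by multiples of \<open>a\<close>. So \<open>\<phi> / a\<close> induces a conformal equivalence of
  \<open>U / f\<close> with the upper half-plane modulo the integers (\<open>simply_parabolic_wave_map\<close>).

  Finally \<open>a\<close> is chosen such that \<open>1 + \<i> / \<surd>3\<close> is a critical point of \<open>f\<close>. The closed quadrant with
  this corner is mapped into one of the quadrants above, hence it lies in \<open>U\<close>, and \<open>f\<close> is not
  injective on \<open>U\<close>.
\<close>

section \<open>Theorems of Schottky and Vitali\<close>

lemma Schottky_cball:
  fixes g :: "complex \<Rightarrow> complex"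
  assumes hol: "g holomorphic_on cball w (3 * R)" and "0 < R"
    and omit: "\<And>z. z \<in> cball w (3 * R) \<Longrightarrow> g z \<noteq> 0 \<and> g z \<noteq> 1"
    and bound: "norm (g w) \<le> M" and v: "v \<in> cball w (2 * R)"
  shows "norm (g v) \<le> exp (pi * exp (pi * (26 + 2 * M)))"
proof -
  define s where "s = (\<lambda>z. w + of_real (3 * R) * z)"
  have s: "s z \<in> cball w (3 * R)" if "z \<in> cball 0 1" for z
    using that \<open>0 < R\<close> by (simp add: s_def dist_norm norm_mult mult_left_le)
  define z where "z = (v - w) / of_real (3 * R)"
  have sz: "s z = v" using \<open>0 < R\<close> by (simp add: s_def z_def)
  have z: "norm z \<le> 2/3"
    using v \<open>0 < R\<close> by (simp add: z_def norm_divide dist_norm norm_minus_commute divide_simps)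
  have "g \<circ> s holomorphic_on cball 0 1"
    by (rule holomorphic_on_compose_gen[OF _ hol])
       (use s in \<open>auto simp: s_def intro!: holomorphic_intros\<close>)
  then have "norm ((g \<circ> s) z) \<le> exp (pi * exp (pi * (2 + 2 * M + 12 * (2/3) / (1 - 2/3))))"
    by (rule Schottky) (use s omit bound z in \<open>auto simp: s_def\<close>)
  then show ?thesis by (simp add: sz algebra_simps)
qed

text \<open>Pointwise convergence on a nonempty open subset suffices: by Montel's theorem every
  subsequence has a convergent subsequence, and all their limits agree by the identity theorem.\<close>

lemma Vitali_convergence:
  fixes F :: "nat \<Rightarrow> complex \<Rightarrow> complex"
  assumes S: "open S" "connected S" and hol: "\<And>n. F n holomorphic_on S"
    and bound: "\<And>K. compact K \<Longrightarrow> K \<subseteq> S \<Longrightarrow> \<exists>B. \<forall>n. \<forall>z\<in>K. norm (F n z) \<le> B"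
    and V: "open V" "V \<noteq> {}" "V \<subseteq> S" and conv: "\<And>z. z \<in> V \<Longrightarrow> convergent (\<lambda>n. F n z)"
  obtains g where "g holomorphic_on S" "\<And>z. z \<in> S \<Longrightarrow> (\<lambda>n. F n z) \<longlonglongrightarrow> g z"
proof -
  have Montel_F: "\<exists>g r. g holomorphic_on S \<and> strict_mono (r :: nat \<Rightarrow> nat) \<and>
      (\<forall>x\<in>S. (\<lambda>n. F (q (r n)) x) \<longlonglongrightarrow> g x)" for q :: "nat \<Rightarrow> nat"
  proof -
    obtain g r where "g holomorphic_on S" "strict_mono (r :: nat \<Rightarrow> nat)"
      "\<And>x. x \<in> S \<Longrightarrow> (\<lambda>n. (F \<circ> q) (r n) x) \<longlonglongrightarrow> g x"
      by (rule Montel[OF \<open>open S\<close>, of "range F" "F \<circ> q"]) (use hol bound in \<open>auto\<close>)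
    then show ?thesis by auto
  qed
  obtain g r where g: "g holomorphic_on S" "strict_mono (r :: nat \<Rightarrow> nat)"
      "\<And>x. x \<in> S \<Longrightarrow> (\<lambda>n. F (r n) x) \<longlonglongrightarrow> g x"
    using Montel_F[of id] by auto
  have limV: "(\<lambda>n. F n z) \<longlonglongrightarrow> g z" if z: "z \<in> V" for z
  proof -
    obtain l where l: "(\<lambda>n. F n z) \<longlonglongrightarrow> l" using conv[OF z] by (auto simp: convergent_def)
    then have "(\<lambda>n. F (r n) z) \<longlonglongrightarrow> l"
      using LIMSEQ_subseq_LIMSEQ[OF l g(2)] by (simp add: o_def)
    then have "l = g z" using g(3)[of z] z V LIMSEQ_unique by blast
    then show ?thesis using l by simp
  qed
  have "(\<lambda>n. F n z) \<longlonglongrightarrow> g z" if z: "z \<in> S" for z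
  proof (rule ccontr)
    assume "\<not> ?thesis"
    then obtain e where e: "e > 0" "\<And>N. \<exists>n\<ge>N. dist (F n z) (g z) \<ge> e"
      unfolding lim_sequentially by (meson not_less)
    define A where "A = {n. dist (F n z) (g z) \<ge> e}"
    have "infinite A" unfolding infinite_nat_iff_unbounded_le A_def using e(2) by auto
    define q where "q = enumerate A"
    have q: "strict_mono q" "\<And>n. q n \<in> A"
      using \<open>infinite A\<close> by (auto simp: q_def strict_mono_enumerate enumerate_in_set)
    obtain h t where h: "h holomorphic_on S" "strict_mono (t :: nat \<Rightarrow> nat)"
      "\<And>x. x \<in> S \<Longrightarrow> (\<lambda>n. F (q (t n)) x) \<longlonglongrightarrow> h x"
      using Montel_F[of q] by auto
    have "h x = g x" if "x \<in> V" for x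
    proof -
      have "strict_mono (q \<circ> t)" using q h by (simp add: strict_mono_o)
      from LIMSEQ_subseq_LIMSEQ[OF limV[OF that] this]
      have "(\<lambda>n. F (q (t n)) x) \<longlonglongrightarrow> g x" by (simp add: o_def)
      then show ?thesis using h(3)[of x] that V LIMSEQ_unique by blast
    qed
    then have "h z = g z"
      using analytic_continuation_open[OF \<open>open V\<close> \<open>open S\<close> \<open>V \<noteq> {}\<close> \<open>connected S\<close> \<open>V \<subseteq> S\<close> h(1) g(1)] z
      by blast
    then have "(\<lambda>n. F (q (t n)) z) \<longlonglongrightarrow> g z" using h(3)[OF z] by simp
    then obtain n where "dist (F (q (t n)) z) (g z) < e"
      using e(1) unfolding lim_sequentially by blast
    then show False using q(2)[of "t n"] by (simp add: A_def)
  qed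
  with g that show ?thesis by blast
qed

section \<open>Iterates and normality\<close>

lemma holomorphic_on_funpow [holomorphic_intros]:
  fixes f :: "complex \<Rightarrow> complex"
  assumes "f holomorphic_on UNIV"
  shows "(f ^^ n) holomorphic_on S"
proof (induction n)
  case 0
  then show ?case by (simp add: id_def)
next
  case (Suc n)
  have "f \<circ> (f ^^ n) holomorphic_on S"
    using Suc assms by (rule holomorphic_on_compose_gen) simp
  then show ?case by (simp add: o_def)
qed

text \<open>A sequence of iterates either repeats one iterate infinitely often, and then has a constant
  subsequence, or its exponents tend to infinity.\<close>

lemma normal_family_on_iterates_if_tendsto_infinity:
  assumes f: "f holomorphic_on UNIV"
    and inf: "tends_to_infinity_locally_uniformly (\<lambda>n. f ^^ n) W"
  shows "normal_family_on (range (\<lambda>n. f ^^ n)) W"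
  unfolding normal_family_on_def
proof (intro allI impI)
  fix s :: "nat \<Rightarrow> complex \<Rightarrow> complex"
  assume "range s \<subseteq> range (\<lambda>n. f ^^ n)"
  then have "\<forall>j. \<exists>n. s j = f ^^ n" by auto
  then obtain k where k: "\<And>j. s j = f ^^ k j" by metis
  show "\<exists>r. strict_mono r \<and>
      ((\<exists>g. g holomorphic_on W \<and>
          (\<forall>K. compact K \<and> K \<subseteq> W \<longrightarrow> uniform_limit K (s \<circ> r) g sequentially)) \<or>
       tends_to_infinity_locally_uniformly (s \<circ> r) W)"
  proof (cases "\<exists>M. infinite {j. k j \<le> M}")
    case True
    then obtain M where M: "infinite {j. k j \<le> M}" by blast
    have "finite (k ` {j. k j \<le> M})" by (rule finite_subset[of _ "{..M}"]) auto
    from pigeonhole_infinite[OF M this] obtain m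
      where m: "infinite {b \<in> {j. k j \<le> M}. k b = k m}" by blast
    define A where "A = {b \<in> {j. k j \<le> M}. k b = k m}"
    define r where "r = enumerate A"
    have "infinite A" unfolding A_def by (rule m)
    then have r: "strict_mono r" "\<And>n. r n \<in> A"
      by (auto simp: r_def strict_mono_enumerate enumerate_in_set)
    have "(s \<circ> r) = (\<lambda>n. f ^^ k m)" using r(2) by (auto simp: A_def k fun_eq_iff)
    then have "uniform_limit K (s \<circ> r) (f ^^ k m) sequentially" for K
      by (auto simp: uniform_limit_iff)
    then show ?thesis using r(1) holomorphic_on_funpow[OF f] by blast
  next
    case False
    have lim: "filterlim k at_top sequentially"
      unfolding filterlim_at_top
    proof
      fix Z
      have "finite {j. k j \<le> Z}" using False by blast
      then have "\<forall>\<^sub>F j in cofinite. \<not> k j \<le> Z" by (simp add: eventually_cofinite)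
      then show "\<forall>\<^sub>F j in sequentially. Z \<le> k j"
        unfolding cofinite_eq_sequentially by (rule eventually_mono) auto
    qed
    have "tends_to_infinity_locally_uniformly (s \<circ> id) W"
      unfolding tends_to_infinity_locally_uniformly_def
    proof (intro allI impI)
      fix K and B :: real
      assume "compact K \<and> K \<subseteq> W"
      then have "\<forall>\<^sub>F n in sequentially. \<forall>z\<in>K. B < norm ((f ^^ n) z)"
        using inf unfolding tends_to_infinity_locally_uniformly_def by blast
      from eventually_compose_filterlim[OF this lim]
      show "\<forall>\<^sub>F n in sequentially. \<forall>z\<in>K. B < norm ((s \<circ> id) n z)" by (simp add: k)
    qed
    then show ?thesis using strict_mono_id by (auto simp: id_def)
  qed
qed

lemma open_fatou_set: "open (fatou_set f)"
proof (rule openI)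
  fix z assume "z \<in> fatou_set f"
  then obtain W where W: "open W" "connected W" "z \<in> W"
      "normal_family_on (range (\<lambda>n. f ^^ n)) W"
    unfolding fatou_set_def by blast
  then have "W \<subseteq> fatou_set f" unfolding fatou_set_def by blast
  then show "\<exists>e>0. ball z e \<subseteq> fatou_set f" using W openE by (meson subset_trans)
qed

section \<open>Points drifting like a translation\<close>

text \<open>The points near which \<open>f\<^sup>n\<close> stays at bounded distance from \<open>n a\<close>, uniformly in \<open>n\<close>. The
  bound refers to \<open>n a\<close> rather than \<open>z + n a\<close>, which makes no difference locally.\<close>

definition drift_set :: "(complex \<Rightarrow> complex) \<Rightarrow> real \<Rightarrow> complex set" where
  "drift_set f a =
     {z. \<exists>r>0. \<exists>C. \<forall>n. \<forall>w\<in>ball z r. norm ((f ^^ n) w - of_nat n * of_real a) \<le> C}"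

lemma open_drift_set: "open (drift_set f a)"
proof (rule openI)
  fix z assume "z \<in> drift_set f a"
  then obtain r C where r: "r > 0"
      "\<And>n w. w \<in> ball z r \<Longrightarrow> norm ((f ^^ n) w - of_nat n * of_real a) \<le> C"
    unfolding drift_set_def by blast
  have "ball z r \<subseteq> drift_set f a"
  proof
    fix w assume "w \<in> ball z r"
    then obtain e where "e > 0" "ball w e \<subseteq> ball z r"
      using open_ball openE by blast
    then show "w \<in> drift_set f a" unfolding drift_set_def using r by blast
  qed
  then show "\<exists>e>0. ball z e \<subseteq> drift_set f a" using r by blast
qed

lemma drift_set_compact_bound:
  assumes "compact K" "K \<subseteq> drift_set f a"
  shows "\<exists>C. \<forall>n. \<forall>z\<in>K. norm ((f ^^ n) z - of_nat n * of_real a) \<le> C"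
proof -
  have "\<forall>z\<in>K. \<exists>r C. r > 0 \<and> (\<forall>n. \<forall>w\<in>ball z r. norm ((f ^^ n) w - of_nat n * of_real a) \<le> C)"
    using assms(2) unfolding drift_set_def by blast
  then obtain r C where rC: "\<And>z. z \<in> K \<Longrightarrow> r z > 0"
      "\<And>z n w. z \<in> K \<Longrightarrow> w \<in> ball z (r z) \<Longrightarrow>
         norm ((f ^^ n) w - of_nat n * of_real a) \<le> C z"
    by metis
  have "K \<subseteq> (\<Union>z\<in>K. ball z (r z))" using rC by fastforce
  then obtain D where D: "D \<subseteq> K" "finite D" "K \<subseteq> (\<Union>z\<in>D. ball z (r z))"
    using compactE_image[OF \<open>compact K\<close>, of K "\<lambda>z. ball z (r z)"] by auto
  have "norm ((f ^^ n) w - of_nat n * of_real a) \<le> (\<Sum>z\<in>D. \<bar>C z\<bar>)" if w: "w \<in> K" for n w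
  proof -
    obtain z where z: "z \<in> D" "w \<in> ball z (r z)" using D w by blast
    then have "norm ((f ^^ n) w - of_nat n * of_real a) \<le> \<bar>C z\<bar>"
      using rC(2)[of z w n] D by force
    also have "\<dots> \<le> (\<Sum>z\<in>D. \<bar>C z\<bar>)" using z D by (intro member_le_sum) auto
    finally show ?thesis .
  qed
  then show ?thesis by blast
qed

lemma drift_set_tendsto_infinity:
  assumes "W \<subseteq> drift_set f a" "a > 0"
  shows "tends_to_infinity_locally_uniformly (\<lambda>n. f ^^ n) W"
  unfolding tends_to_infinity_locally_uniformly_def
proof (intro allI impI)
  fix K and B :: real
  assume "compact K \<and> K \<subseteq> W"
  then obtain C where C: "\<And>n z. z \<in> K \<Longrightarrow> norm ((f ^^ n) z - of_nat n * of_real a) \<le> C"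
    using drift_set_compact_bound[of K f a] assms by blast
  have "B < norm ((f ^^ n) z)" if "z \<in> K" "B + C < real n * a" for n z
  proof -
    have "norm (of_nat n * of_real a :: complex) = real n * a"
      using \<open>a > 0\<close> by (simp add: norm_mult)
    moreover have "norm (of_nat n * of_real a :: complex) \<le>
        norm ((f ^^ n) z) + norm ((f ^^ n) z - of_nat n * of_real a)"
      by (metis norm_minus_commute norm_triangle_sub)
    ultimately show ?thesis using C[OF that(1), of n] that(2) by linarith
  qed
  moreover have "\<forall>\<^sub>F n in sequentially. B + C < real n * a"
  proof -
    have "filterlim (\<lambda>n. real n * a) at_top sequentially"
      using \<open>a > 0\<close> filterlim_at_top_mult_tendsto_pos[OF tendsto_const _ filterlim_real_sequentially]
      by blast
    then show ?thesis by (simp add: filterlim_at_top_dense)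
  qed
  ultimately show "\<forall>\<^sub>F n in sequentially. \<forall>z\<in>K. B < norm ((f ^^ n) z)"
    by (auto elim!: eventually_mono)
qed

lemma drift_set_subset_fatou_set:
  assumes "f holomorphic_on UNIV" "a > 0"
  shows "drift_set f a \<subseteq> fatou_set f"
proof
  fix z assume "z \<in> drift_set f a"
  then obtain r where r: "r > 0" "ball z r \<subseteq> drift_set f a"
    using open_drift_set openE by blast
  then have "normal_family_on (range (\<lambda>n. f ^^ n)) (ball z r)"
    using assms drift_set_tendsto_infinity normal_family_on_iterates_if_tendsto_infinity by blast
  then show "z \<in> fatou_set f" unfolding fatou_set_def
    using r(1) by (intro CollectI exI[of _ "ball z r"]) auto
qed

lemma drift_set_preimage:
  assumes f: "f holomorphic_on UNIV" and fz: "f z \<in> drift_set f a"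
  shows "z \<in> drift_set f a"
proof -
  obtain r C where r: "r > 0"
      "\<And>n w. w \<in> ball (f z) r \<Longrightarrow> norm ((f ^^ n) w - of_nat n * of_real a) \<le> C"
    using fz unfolding drift_set_def by blast
  have "isCont f z"
    using holomorphic_on_imp_continuous_on[OF f] by (simp add: continuous_on_eq_continuous_at)
  then obtain d where d: "d > 0" "\<And>w. dist w z < d \<Longrightarrow> dist (f w) (f z) < r"
    unfolding continuous_at_eps_delta using r(1) by (metis dist_norm)
  have "norm ((f ^^ n) w - of_nat n * of_real a) \<le> norm z + d + C + \<bar>a\<bar>"
    if w: "w \<in> ball z d" for n w
  proof (cases n)
    case 0
    have "norm w \<le> norm z + d"
      using w norm_triangle_sub[of w z] by (simp add: dist_norm norm_minus_commute)
    moreover have "0 \<le> C" using order_trans[OF norm_ge_zero r(2)[of "f z" 0]] r(1) by simp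
    ultimately show ?thesis using 0 by simp
  next
    case (Suc m)
    have "(f ^^ n) w - of_nat n * of_real a = ((f ^^ m) (f w) - of_nat m * of_real a) - of_real a"
      by (simp add: Suc funpow_swap1 algebra_simps)
    then have "norm ((f ^^ n) w - of_nat n * of_real a) \<le>
        norm ((f ^^ m) (f w) - of_nat m * of_real a) + \<bar>a\<bar>"
      by (metis norm_of_real norm_triangle_ineq4)
    moreover have "f w \<in> ball (f z) r" using d(2)[of w] w by (simp add: dist_commute)
    ultimately show ?thesis using r(2)[of "f w" m] d norm_ge_zero[of z] by linarith
  qed
  then show ?thesis unfolding drift_set_def using d(1) by blast
qed

lemma drift_set_image:
  assumes f: "f holomorphic_on UNIV" "\<not> f constant_on UNIV" and z: "z \<in> drift_set f a"
  shows "f z \<in> drift_set f a"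
proof -
  obtain r C where r: "r > 0"
      "\<And>n w. w \<in> ball z r \<Longrightarrow> norm ((f ^^ n) w - of_nat n * of_real a) \<le> C"
    using z unfolding drift_set_def by blast
  have "open (f ` ball z r)"
    by (rule open_mapping_thm[OF f(1)]) (use f in auto)
  moreover have "f z \<in> f ` ball z r" using r(1) by simp
  ultimately obtain e where e: "e > 0" "ball (f z) e \<subseteq> f ` ball z r"
    using openE by blast
  have "norm ((f ^^ n) v - of_nat n * of_real a) \<le> C + \<bar>a\<bar>" if v: "v \<in> ball (f z) e" for n v
  proof -
    obtain w where w: "w \<in> ball z r" "v = f w" using e(2) v by blast
    have "(f ^^ n) v - of_nat n * of_real a =
        ((f ^^ Suc n) w - of_nat (Suc n) * of_real a) - (- of_real a)"
      by (simp add: w funpow_swap1 algebra_simps)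
    then have "norm ((f ^^ n) v - of_nat n * of_real a) \<le>
        norm ((f ^^ Suc n) w - of_nat (Suc n) * of_real a) + \<bar>a\<bar>"
      by (metis norm_minus_cancel norm_of_real norm_triangle_ineq4)
    then show ?thesis using r(2)[OF w(1), of "Suc n"] by linarith
  qed
  then show ?thesis unfolding drift_set_def using e(1) by blast
qed

section \<open>Fatou components of maps that fix the integers\<close>

text \<open>An orbit that hits an integer stays there, whereas the orbit of \<open>w\<close> tends to infinity. Normality
  on \<open>W\<close> excludes that both occur: a holomorphic limit fails at \<open>w\<close>, the limit infinity fails at \<open>z\<close>.\<close>

lemma normal_iterates_avoid_integers:
  assumes fix_int: "\<And>m. f (of_int m) = of_int m" and "a > 0"
    and normal: "normal_family_on (range (\<lambda>n. f ^^ n)) W"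
    and w: "w \<in> W" "w \<in> drift_set f a" and z: "z \<in> W"
  shows "(f ^^ n) z \<noteq> of_int m"
proof
  assume hit: "(f ^^ n) z = of_int m"
  have stay: "(f ^^ k) (of_int m) = of_int m" for k
    by (induction k) (auto simp: fix_int)
  have const: "(f ^^ k) z = of_int m" if "k \<ge> n" for k
  proof -
    have "(f ^^ k) z = (f ^^ (k - n)) ((f ^^ n) z)"
      by (metis that comp_apply funpow_add le_add_diff_inverse2)
    then show ?thesis by (simp add: hit stay)
  qed
  have "tends_to_infinity_locally_uniformly (\<lambda>n. f ^^ n) {w}"
    using drift_set_tendsto_infinity[of "{w}" f a] w \<open>a > 0\<close> by simp
  then have inf_w: "\<forall>\<^sub>F k in sequentially. B < norm ((f ^^ k) w)" for B
    unfolding tends_to_infinity_locally_uniformly_def by (elim allE[of _ "{w}"]) simp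
  obtain r where r: "strict_mono (r :: nat \<Rightarrow> nat)"
    and alt: "(\<exists>g. g holomorphic_on W \<and>
           (\<forall>K. compact K \<and> K \<subseteq> W \<longrightarrow> uniform_limit K ((\<lambda>n. f ^^ n) \<circ> r) g sequentially))
        \<or> tends_to_infinity_locally_uniformly ((\<lambda>n. f ^^ n) \<circ> r) W"
    using normal unfolding normal_family_on_def by blast
  have r_top: "filterlim r at_top sequentially" using r by (rule filterlim_subseq)
  from alt show False
  proof
    assume "\<exists>g. g holomorphic_on W \<and>
           (\<forall>K. compact K \<and> K \<subseteq> W \<longrightarrow> uniform_limit K ((\<lambda>n. f ^^ n) \<circ> r) g sequentially)"
    then obtain g where "uniform_limit {w} ((\<lambda>n. f ^^ n) \<circ> r) g sequentially"
      using w(1) by (metis compact_sing empty_subsetI insert_subset)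
    from tendsto_uniform_limitI[OF this, of w]
    have "(\<lambda>k. (f ^^ r k) w) \<longlonglongrightarrow> g w" by simp
    then have "\<forall>\<^sub>F k in sequentially. norm ((f ^^ r k) w) < norm (g w) + 1"
      using order_tendstoD(2)[OF tendsto_norm, of "\<lambda>k. (f ^^ r k) w" "g w" sequentially] by simp
    moreover have "\<forall>\<^sub>F k in sequentially. norm (g w) + 1 < norm ((f ^^ r k) w)"
      using eventually_compose_filterlim[OF inf_w r_top] .
    ultimately have "\<forall>\<^sub>F k::nat in sequentially. False" by eventually_elim simp
    then show False by simp
  next
    assume "tends_to_infinity_locally_uniformly ((\<lambda>n. f ^^ n) \<circ> r) W"
    then have "\<forall>\<^sub>F k in sequentially. \<forall>x\<in>{z}. norm (of_int m :: complex) < norm (((\<lambda>n. f ^^ n) \<circ> r) k x)"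
      unfolding tends_to_infinity_locally_uniformly_def using z by (elim allE[of _ "{z}"]) simp
    moreover have "\<forall>\<^sub>F k in sequentially. r k \<ge> n"
      using r_top by (simp add: filterlim_at_top)
    ultimately have "\<forall>\<^sub>F k::nat in sequentially. False"
      by eventually_elim (simp add: const)
    then show False by simp
  qed
qed

text \<open>The drift set is relatively open and closed in \<open>U\<close>. Closedness follows from Schottky's theorem:
  near a point \<open>w\<close> of the drift set the function \<open>f\<^sup>n - \<lfloor>n a\<rfloor>\<close> is bounded at \<open>w\<close> independently of \<open>n\<close>, and it
  omits 0 and 1 on the whole domain of normality, so that its bound extends to a disc whose size
  depends only on that domain.\<close>

lemma fatou_component_subset_drift_set:
  assumes f: "f holomorphic_on UNIV" and fix_int: "\<And>m. f (of_int m) = of_int m" and "a > 0"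
    and U: "U \<in> components (fatou_set f)" and p: "p \<in> U" "p \<in> drift_set f a"
  shows "U \<subseteq> drift_set f a"
proof -
  have local: "\<exists>R>0. ball z R \<inter> drift_set f a \<noteq> {} \<longrightarrow> z \<in> drift_set f a" if z: "z \<in> U" for z
  proof -
    have "z \<in> fatou_set f" using U z in_components_subset by blast
    then obtain W where W: "open W" "connected W" "z \<in> W"
      and normal: "normal_family_on (range (\<lambda>n. f ^^ n)) W"
      unfolding fatou_set_def by blast
    obtain R0 where R0: "R0 > 0" "ball z R0 \<subseteq> W" using W openE by blast
    define R where "R = R0 / 5"
    have R: "R > 0" "ball z (5 * R) \<subseteq> W" using R0 by (auto simp: R_def)
    have "z \<in> drift_set f a" if w: "w \<in> ball z R" "w \<in> drift_set f a" for w
    proof -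
      have sub: "cball w (3 * R) \<subseteq> ball z (5 * R)"
      proof
        fix x assume "x \<in> cball w (3 * R)"
        then show "x \<in> ball z (5 * R)"
          using w(1) R(1) dist_triangle[of z x w] by simp
      qed
      have wW: "w \<in> W" using w R by auto
      obtain C where C: "\<And>n. norm ((f ^^ n) w - of_nat n * of_real a) \<le> C"
        using drift_set_compact_bound[of "{w}" f a] w by auto
      have "norm ((f ^^ n) v - of_nat n * of_real a)
          \<le> exp (pi * exp (pi * (26 + 2 * (C + 1)))) + 1" if v: "v \<in> ball z R" for n v
      proof -
        define g where "g = (\<lambda>x. (f ^^ n) x - of_int \<lfloor>real n * a\<rfloor>)"
        have frac: "norm (of_nat n * of_real a - of_int \<lfloor>real n * a\<rfloor> :: complex) \<le> 1"
        proof -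
          have "(of_nat n * of_real a - of_int \<lfloor>real n * a\<rfloor> :: complex) = of_real (frac (real n * a))"
            by (simp add: frac_def)
          then show ?thesis
            using frac_lt_1[of "real n * a"] frac_ge_0[of "real n * a"]
            by (simp only: norm_of_real)
        qed
        have shift: "g x = ((f ^^ n) x - of_nat n * of_real a) + (of_nat n * of_real a - of_int \<lfloor>real n * a\<rfloor>)" for x
          by (simp add: g_def)
        have "norm (g w) \<le> C + 1"
          unfolding shift by (rule norm_triangle_le) (use C[of n] frac in linarith)
        moreover have "g x \<noteq> 0 \<and> g x \<noteq> 1" if "x \<in> cball w (3 * R)" for x
        proof -
          have "x \<in> W" using that sub R(2) by blast
          note avoid = normal_iterates_avoid_integers[OF fix_int \<open>a > 0\<close> normal wW w(2) this]
          show ?thesis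
            using avoid[of n "\<lfloor>real n * a\<rfloor>"] avoid[of n "\<lfloor>real n * a\<rfloor> + 1"]
            by (auto simp: g_def algebra_simps)
        qed
        moreover have "g holomorphic_on cball w (3 * R)"
          unfolding g_def by (intro holomorphic_intros f)
        moreover have "v \<in> cball w (2 * R)"
          using v w(1) dist_triangle2[of w v z] by (simp add: dist_commute)
        ultimately have "norm (g v) \<le> exp (pi * exp (pi * (26 + 2 * (C + 1))))"
          using Schottky_cball R(1) by blast
        moreover have "norm ((f ^^ n) v - of_nat n * of_real a) \<le> norm (g v)
            + norm (of_nat n * of_real a - of_int \<lfloor>real n * a\<rfloor> :: complex)"
          using norm_triangle_ineq4[of "g v" "of_nat n * of_real a - of_int \<lfloor>real n * a\<rfloor>"]
          by (simp add: g_def)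
        ultimately show ?thesis using frac by linarith
      qed
      then show ?thesis unfolding drift_set_def using R(1) by blast
    qed
    then show ?thesis using R(1) by blast
  qed
  have "closedin (top_of_set U) (U \<inter> drift_set f a)"
    unfolding closedin_limpt
  proof (intro conjI allI impI)
    fix z assume z: "z islimpt (U \<inter> drift_set f a) \<and> z \<in> U"
    then obtain R where R: "R > 0" "ball z R \<inter> drift_set f a \<noteq> {} \<longrightarrow> z \<in> drift_set f a"
      using local by blast
    obtain x where "x \<in> drift_set f a" "dist x z < R"
      using z R(1) unfolding islimpt_approachable by blast
    then have "x \<in> ball z R \<inter> drift_set f a" by (simp add: dist_commute)
    then show "z \<in> U \<inter> drift_set f a" using R(2) z by blast
  qed auto
  moreover have "openin (top_of_set U) (U \<inter> drift_set f a)"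
    using open_drift_set openin_open_Int by blast
  moreover have "connected U" using U in_components_connected by blast
  ultimately have "U \<inter> drift_set f a = {} \<or> U \<inter> drift_set f a = U"
    unfolding connected_clopen by blast
  then show ?thesis using p by blast
qed

section \<open>A criterion for simply parabolic quotients\<close>

lemma equiv_integer_difference:
  fixes F :: "complex \<Rightarrow> complex"
  assumes r: "\<And>z w. (z, w) \<in> r \<longleftrightarrow> z \<in> A \<and> w \<in> A \<and> F w - F z \<in> \<int>"
  shows "equiv A r"
proof (rule equivI)
  show "r \<subseteq> A \<times> A" using r by auto
  show "refl_on A r" by (rule refl_onI) (simp add: r)
  show "sym r"
  proof (rule symI)
    fix z w assume "(z, w) \<in> r"
    then show "(w, z) \<in> r" using Ints_minus[of "F w - F z"] by (simp add: r)
  qed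
  show "trans r"
  proof (rule transI)
    fix x y z assume "(x, y) \<in> r" "(y, z) \<in> r"
    then show "(x, z) \<in> r" using Ints_add[of "F y - F x" "F z - F y"] by (simp add: r)
  qed
qed

text \<open>A semiconjugacy \<open>\<psi>\<close> of \<open>f\<close> to \<open>z \<mapsto> z + 1\<close> on the upper half-plane induces the conformal equivalence of
  the quotients if it separates grand orbits (\<open>inj\<close>) and has, up to integer translations, local
  holomorphic sections over every point (\<open>sect\<close>). Neither injectivity nor surjectivity of \<open>\<psi>\<close> itself is
  required.\<close>

lemma simply_parabolicI:
  fixes f \<psi> :: "complex \<Rightarrow> complex"
  assumes U: "open U" and fU: "f ` U \<subseteq> U" and hol: "\<psi> holomorphic_on U"
    and Im_pos: "\<And>u. u \<in> U \<Longrightarrow> 0 < Im (\<psi> u)"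
    and conj: "\<And>u. u \<in> U \<Longrightarrow> \<psi> (f u) = \<psi> u + 1"
    and inj: "\<And>u v. u \<in> U \<Longrightarrow> v \<in> U \<Longrightarrow> \<psi> u = \<psi> v \<Longrightarrow> \<exists>n. (f ^^ n) u = (f ^^ n) v"
    and sect: "\<And>w. 0 < Im w \<Longrightarrow> \<exists>N g n. open N \<and> w \<in> N \<and> g holomorphic_on N \<and> g ` N \<subseteq> U \<and>
       (\<forall>z\<in>N. \<psi> (g z) = z + of_nat n)"
  shows "simply_parabolic f U"
proof -
  define H where "H = {z::complex. 0 < Im z}"
  define S where "S = integer_translation_rel H"
  define R where "R = grand_orbit_rel f U"
  have funpow_U: "(f ^^ n) u \<in> U" if "u \<in> U" for n u
    using that fU by (induction n) auto
  have \<psi>_funpow: "\<psi> ((f ^^ n) u) = \<psi> u + of_nat n" if "u \<in> U" for n u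
    using that by (induction n) (simp_all add: conj funpow_U)
  have \<psi>_H: "\<psi> u \<in> H" if "u \<in> U" for u using Im_pos[OF that] by (simp add: H_def)

  have S_iff: "(z, w) \<in> S \<longleftrightarrow> z \<in> H \<and> w \<in> H \<and> w - z \<in> \<int>" for z w
    by (simp add: S_def integer_translation_rel_def)
  have R_iff: "(u, v) \<in> R \<longleftrightarrow> u \<in> U \<and> v \<in> U \<and> \<psi> v - \<psi> u \<in> \<int>" for u v
  proof
    assume "(u, v) \<in> R"
    then obtain m n where uv: "u \<in> U" "v \<in> U" "(f ^^ m) u = (f ^^ n) v"
      by (auto simp: R_def grand_orbit_rel_def)
    then have "\<psi> u + of_nat m = \<psi> v + of_nat n" by (metis \<psi>_funpow)
    then have "\<psi> v - \<psi> u = of_int (int m - int n)" by (simp add: algebra_simps)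
    then show "u \<in> U \<and> v \<in> U \<and> \<psi> v - \<psi> u \<in> \<int>" using uv by (metis Ints_of_int)
  next
    assume uv: "u \<in> U \<and> v \<in> U \<and> \<psi> v - \<psi> u \<in> \<int>"
    then obtain k where k: "\<psi> v - \<psi> u = of_int k" by (auto elim: Ints_cases)
    define i j where "i = nat k" and "j = nat (- k)"
    have "k = int i - int j" by (simp add: i_def j_def)
    then have "of_int k = (of_nat i - of_nat j :: complex)" by simp
    then have "\<psi> ((f ^^ i) u) = \<psi> ((f ^^ j) v)"
      using k uv by (simp add: \<psi>_funpow algebra_simps)
    then obtain n where "(f ^^ n) ((f ^^ i) u) = (f ^^ n) ((f ^^ j) v)"
      using inj funpow_U uv by blast
    then have "(f ^^ (n + i)) u = (f ^^ (n + j)) v" by (simp add: funpow_add)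
    then show "(u, v) \<in> R" unfolding R_def grand_orbit_rel_def using uv by blast
  qed
  have Ints_trans: "x - z \<in> \<int>" if "x - y \<in> \<int>" "y - z \<in> \<int>" for x y z :: complex
    using Ints_add[OF that] by simp
  have eqS: "equiv H S" by (rule equiv_integer_difference[of S H "\<lambda>z. z"]) (rule S_iff)
  have eqR: "equiv U R" by (rule equiv_integer_difference[of R U \<psi>]) (rule R_iff)
  have S_class: "S `` {z} = S `` {w}" if "z \<in> H" "w \<in> H" "w - z \<in> \<int>" for z w
    using equiv_class_eq[OF eqS] S_iff that by blast
  have R_class: "R `` {u} = R `` {v}" if "u \<in> U" "v \<in> U" "\<psi> v - \<psi> u \<in> \<int>" for u v
    using equiv_class_eq[OF eqR] R_iff that by blast

  \<comment> \<open>The image of a grand orbit under \<open>\<psi>\<close> lies in one class of translates; \<open>\<Phi>\<close> saturates it.\<close>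
  define \<Phi> where "\<Phi> = (\<lambda>c. S `` (\<psi> ` c))"
  have \<Phi>_class: "\<Phi> (R `` {u}) = S `` {\<psi> u}" if u: "u \<in> U" for u
  proof
    show "\<Phi> (R `` {u}) \<subseteq> S `` {\<psi> u}"
      unfolding \<Phi>_def using u \<psi>_H Ints_trans by (auto simp: S_iff R_iff)
    show "S `` {\<psi> u} \<subseteq> \<Phi> (R `` {u})"
      unfolding \<Phi>_def using u by (auto simp: R_iff)
  qed
  have bij: "bij_betw \<Phi> (U // R) (H // S)"
    unfolding bij_betw_def
  proof
    show "inj_on \<Phi> (U // R)"
    proof (rule inj_onI)
      fix c d assume cd: "c \<in> U // R" "d \<in> U // R" "\<Phi> c = \<Phi> d"
      obtain u where u: "u \<in> U" "c = R `` {u}" using cd(1) by (rule quotientE)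
      obtain v where v: "v \<in> U" "d = R `` {v}" using cd(2) by (rule quotientE)
      note uv = u v
      then have "S `` {\<psi> u} = S `` {\<psi> v}" using cd \<Phi>_class[of u] \<Phi>_class[of v] by simp
      then have "(\<psi> u, \<psi> v) \<in> S" using eq_equiv_class[OF _ eqS \<psi>_H[OF v(1)]] by blast
      then show "c = d" using R_class[of u v] uv by (simp add: S_iff)
    qed
    show "\<Phi> ` (U // R) = H // S"
    proof
      show "\<Phi> ` (U // R) \<subseteq> H // S"
      proof
        fix C assume "C \<in> \<Phi> ` (U // R)"
        then obtain c where c: "c \<in> U // R" "C = \<Phi> c" by blast
        from c(1) obtain u where "u \<in> U" "c = R `` {u}" by (rule quotientE)
        then show "C \<in> H // S" using c(2) \<Phi>_class quotientI[OF \<psi>_H] by simp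
      qed
      show "H // S \<subseteq> \<Phi> ` (U // R)"
      proof
        fix C assume "C \<in> H // S"
        then obtain w where w: "w \<in> H" "C = S `` {w}" by (rule quotientE)
        then have "0 < Im w" by (simp add: H_def)
        from sect[OF this] obtain N g n where s: "w \<in> N" "g ` N \<subseteq> U"
            "\<forall>z\<in>N. \<psi> (g z) = z + of_nat n" by blast
        then have "g w \<in> U" "\<psi> (g w) - w \<in> \<int>" by auto
        then have "C = \<Phi> (R `` {g w})" using S_class[of w "\<psi> (g w)"] w \<psi>_H \<Phi>_class by simp
        then show "C \<in> \<Phi> ` (U // R)" using quotientI[OF \<open>g w \<in> U\<close>] by blast
      qed
    qed
  qed

  have main: "quotient_holomorphic_on H S W h \<longleftrightarrow>
      quotient_holomorphic_on U R {c \<in> U // R. \<Phi> c \<in> W} (h \<circ> \<Phi>)"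
    if W: "W \<subseteq> H // S" for W h
  proof -
    define W' where "W' = {c \<in> U // R. \<Phi> c \<in> W}"
    have in_W: "z \<in> \<Union>W \<longleftrightarrow> z \<in> H \<and> S `` {z} \<in> W" for z
    proof
      assume "z \<in> \<Union>W"
      then obtain C where C: "C \<in> W" "z \<in> C" by blast
      then have "C \<in> H // S" using W by blast
      then obtain w where w: "w \<in> H" "C = S `` {w}" by (rule quotientE)
      then have "z \<in> H" "z - w \<in> \<int>" using C by (auto simp: S_iff)
      then show "z \<in> H \<and> S `` {z} \<in> W" using S_class[of w z] w C by simp
    next
      assume "z \<in> H \<and> S `` {z} \<in> W"
      moreover have "z \<in> S `` {z}" if "z \<in> H" using that by (simp add: S_iff)
      ultimately show "z \<in> \<Union>W" by blast
    qed
    have W'_eq: "\<Union>W' = {u \<in> U. \<psi> u \<in> \<Union>W}"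
    proof (intro set_eqI iffI)
      fix u assume "u \<in> \<Union>W'"
      then obtain c where c: "c \<in> U // R" "\<Phi> c \<in> W" "u \<in> c" unfolding W'_def by blast
      obtain v where "v \<in> U" "c = R `` {v}" using c(1) by (rule quotientE)
      then have v: "v \<in> U" "u \<in> R `` {v}" "\<Phi> (R `` {v}) \<in> W" using c by auto
      then have u: "u \<in> U" "\<psi> u - \<psi> v \<in> \<int>" by (auto simp: R_iff)
      then have "\<Phi> (R `` {u}) \<in> W" using R_class[of v u] v by simp
      then show "u \<in> {u \<in> U. \<psi> u \<in> \<Union>W}" using u \<Phi>_class in_W \<psi>_H by auto
    next
      fix u assume "u \<in> {u \<in> U. \<psi> u \<in> \<Union>W}"
      then have u: "u \<in> U" "S `` {\<psi> u} \<in> W" using in_W by auto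
      then have "R `` {u} \<in> W'" unfolding W'_def using \<Phi>_class quotientI[OF u(1)] by simp
      moreover have "u \<in> R `` {u}" using u by (simp add: R_iff)
      ultimately show "u \<in> \<Union>W'" by blast
    qed
    define k where "k = (\<lambda>u. (h \<circ> \<Phi>) (R `` {u}))"
    have k: "k u = h (S `` {\<psi> u})" if "u \<in> U" for u
      using \<Phi>_class[OF that] by (simp add: k_def)
    have "open (\<Union>W) \<and> (\<lambda>z. h (S `` {z})) holomorphic_on \<Union>W \<longleftrightarrow>
        open (\<Union>W') \<and> k holomorphic_on \<Union>W'"
    proof
      assume *: "open (\<Union>W) \<and> (\<lambda>z. h (S `` {z})) holomorphic_on \<Union>W"
      have "open (U \<inter> \<psi> -` \<Union>W)"
        using continuous_open_preimage[OF holomorphic_on_imp_continuous_on[OF hol] U] * by blast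
      moreover have "U \<inter> \<psi> -` \<Union>W = \<Union>W'" unfolding W'_eq by auto
      ultimately have "open (\<Union>W')" by simp
      moreover have "(\<lambda>z. h (S `` {z})) \<circ> \<psi> holomorphic_on \<Union>W'"
        by (rule holomorphic_on_compose_gen[of _ _ _ "\<Union>W"])
           (use * in \<open>auto simp: W'_eq intro: holomorphic_on_subset[OF hol]\<close>)
      then have "k holomorphic_on \<Union>W'"
        by (rule holomorphic_transform) (auto simp: W'_eq k)
      ultimately show "open (\<Union>W') \<and> k holomorphic_on \<Union>W'" ..
    next
      assume *: "open (\<Union>W') \<and> k holomorphic_on \<Union>W'"
      have local: "\<exists>N. open N \<and> w \<in> N \<and> N \<subseteq> \<Union>W \<and> (\<lambda>z. h (S `` {z})) holomorphic_on N"
        if w: "w \<in> \<Union>W" for w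
      proof -
        have "w \<in> H" using w in_W by blast
        then have "0 < Im w" by (simp add: H_def)
        from sect[OF this] obtain N g n where N: "open N" "w \<in> N" "g holomorphic_on N" "g ` N \<subseteq> U"
            "\<And>z. z \<in> N \<Longrightarrow> \<psi> (g z) = z + of_nat n" by blast
        define M where "M = N \<inter> g -` \<Union>W'"
        have "open M" unfolding M_def
          using continuous_open_preimage[OF holomorphic_on_imp_continuous_on[OF N(3)] N(1)] * by blast
        have shift: "S `` {z} = S `` {\<psi> (g z)} \<and> z \<in> H" if "z \<in> N" for z
        proof -
          have "\<psi> (g z) \<in> H" using N(4) that \<psi>_H by blast
          moreover from this have "z \<in> H" using N(5)[OF that] by (simp add: H_def)
          ultimately show ?thesis using S_class[of z "\<psi> (g z)"] N(5)[OF that] by simp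
        qed
        have "w \<in> M" unfolding M_def W'_eq using N(2,4) shift[of w] w in_W \<psi>_H by auto
        moreover have "M \<subseteq> \<Union>W"
        proof
          fix z assume "z \<in> M"
          then have "z \<in> N" "\<psi> (g z) \<in> \<Union>W" unfolding M_def W'_eq by auto
          then show "z \<in> \<Union>W" using shift[of z] in_W by simp
        qed
        moreover have "(\<lambda>z. h (S `` {z})) holomorphic_on M"
        proof (rule holomorphic_transform)
          show "k \<circ> g holomorphic_on M"
            by (rule holomorphic_on_compose_gen[of _ _ _ "\<Union>W'"])
               (use * N in \<open>auto simp: M_def intro: holomorphic_on_subset\<close>)
          show "(k \<circ> g) z = h (S `` {z})" if "z \<in> M" for z
            using that shift[of z] k[of "g z"] N(4) by (auto simp: M_def)
        qed
        ultimately show ?thesis using \<open>open M\<close> by blast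
      qed
      have "open (\<Union>W)"
        by (rule Topological_Spaces.openI) (use local in blast)
      moreover have "(\<lambda>z. h (S `` {z})) holomorphic_on \<Union>W"
        unfolding holomorphic_on_def
      proof
        fix w assume "w \<in> \<Union>W"
        from local[OF this] obtain N where N: "open N" "w \<in> N"
          "(\<lambda>z. h (S `` {z})) holomorphic_on N" by blast
        show "(\<lambda>z. h (S `` {z})) field_differentiable at w within \<Union>W"
          using holomorphic_on_imp_differentiable_at[OF N(3,1,2)]
          by (rule field_differentiable_at_within)
      qed
      ultimately show "open (\<Union>W) \<and> (\<lambda>z. h (S `` {z})) holomorphic_on \<Union>W" ..
    qed
    moreover have "W' \<subseteq> U // R" by (auto simp: W'_def)
    ultimately show ?thesis
      using W by (simp add: quotient_holomorphic_on_def W'_def[symmetric] k_def)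
  qed
  show ?thesis
    unfolding simply_parabolic_def conformally_equivalent_quotients_def
    using bij main unfolding H_def R_def S_def by blast
qed

section \<open>The entire functions\<close>

text \<open>The factor \<open>exp (2 \<pi> \<i> z\<^sup>2)\<close>, which equals 1 at the integers and decays in the first quadrant.\<close>

definition wave :: "complex \<Rightarrow> complex" where
  "wave z = exp (2 * of_real pi * \<i> * z\<^sup>2)"

text \<open>A perturbation of the translation by \<open>a\<close> in the first quadrant that fixes every integer.\<close>

definition wave_map :: "real \<Rightarrow> complex \<Rightarrow> complex" where
  "wave_map a z = z + of_real a * (1 - wave z)"

lemma norm_wave: "norm (wave z) = exp (- 4 * pi * Re z * Im z)"
  by (simp add: wave_def power2_eq_square algebra_simps)

lemma holomorphic_wave_map: "wave_map a holomorphic_on S"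
  unfolding wave_map_def wave_def by (intro holomorphic_intros)

lemma wave_of_int: "wave (of_int m) = 1"
proof -
  have "2 * of_real pi * \<i> * (of_int m)\<^sup>2 = \<i> * of_int (m\<^sup>2) * (of_real pi * 2)"
    by (simp add: algebra_simps)
  then show ?thesis unfolding wave_def exp_eq_1
    by (auto simp: power2_eq_square intro!: exI[of _ "m * m"])
qed

lemma wave_map_of_int: "wave_map a (of_int m) = of_int m"
  by (simp add: wave_map_def wave_of_int)

lemma wave_map_not_identity:
  assumes "a \<noteq> 0"
  obtains z where "wave_map a z \<noteq> z"
proof
  have "norm (wave (1 + \<i>)) \<noteq> 1" by (simp add: norm_wave)
  then have "wave (1 + \<i>) \<noteq> 1" by (metis norm_one)
  then show "wave_map a (1 + \<i>) \<noteq> 1 + \<i>" using assms by (simp add: wave_map_def)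
qed

lemma transcendental_entire_wave_map:
  assumes "a \<noteq> 0"
  shows "transcendental_entire (wave_map a)"
  unfolding transcendental_entire_def
proof (intro conjI holomorphic_wave_map notI)
  assume "\<exists>p. wave_map a = poly p"
  then obtain p where p: "\<And>z. wave_map a z = poly p z" by auto
  have "poly p (of_int m) = of_int m" for m
    using p[of "of_int m"] wave_map_of_int[of a m] by simp
  then have "range of_int \<subseteq> {z. poly (p - [:0, 1:]) z = 0}" by auto
  moreover have "infinite (range (of_int :: int \<Rightarrow> complex))"
    using finite_imageD[of "of_int :: int \<Rightarrow> complex" UNIV] infinite_UNIV_int
    by (auto simp: inj_on_def)
  ultimately have "p - [:0, 1:] = 0" using poly_roots_finite finite_subset by blast
  then have "p = [:0, 1:]" by simp
  then have "wave_map a z = z" for z using p by simp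
  then show False using wave_map_not_identity[OF assms] by blast
qed

lemma not_constant_wave_map: "\<not> wave_map a constant_on UNIV"
proof
  assume "wave_map a constant_on UNIV"
  then have "wave_map a (of_int 0) = wave_map a (of_int 1)" by (auto simp: constant_on_def)
  then show False unfolding wave_map_of_int by simp
qed

section \<open>Orbits in quadrants\<close>

definition quadrant :: "real \<Rightarrow> real \<Rightarrow> complex set" where
  "quadrant X \<delta> = {z. X < Re z \<and> \<delta> < Im z}"

text \<open>An upper bound for the total deviation from \<open>z + n a\<close> of an orbit starting in the quadrant: the
  sum of the geometric series with first term \<open>a exp (- 2 \<pi> X \<delta>)\<close> and ratio \<open>exp (- 2 \<pi> \<delta>)\<close>.\<close>

definition drift_error :: "real \<Rightarrow> real \<Rightarrow> real \<Rightarrow> real" where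
  "drift_error a X \<delta> = a * exp (- 2 * pi * X * \<delta>) / (1 - exp (- 2 * pi * \<delta>))"

text \<open>The condition under which this bound is justified: an orbit that deviates from \<open>z + n a\<close> by at
  most \<open>min (\<delta> / 2) 1\<close> stays above height \<open>\<delta> / 2\<close> and moves to the right.\<close>

definition tame :: "real \<Rightarrow> real \<Rightarrow> real \<Rightarrow> bool" where
  "tame a X \<delta> \<longleftrightarrow> 0 \<le> X \<and> 0 < \<delta> \<and> drift_error a X \<delta> \<le> min (\<delta> / 2) 1"

text \<open>Both bounds are proved in one induction: after \<open>n\<close> steps the real part is at least \<open>X + n\<close> and
  the imaginary part at least \<open>\<delta> / 2\<close>, whence the next error is at most the \<open>n\<close>-th term of the
  geometric series.\<close>

lemma orbit_estimate:
  assumes a: "a \<ge> 2" and tame: "tame a X \<delta>" and z: "X \<le> Re z" "\<delta> \<le> Im z"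
  shows "norm ((wave_map a ^^ n) z - z - of_nat n * of_real a)
           \<le> drift_error a X \<delta> * (1 - exp (- 2 * pi * \<delta>) ^ n)" (is ?bound)
    and "norm ((wave_map a ^^ Suc n) z - (wave_map a ^^ n) z - of_real a)
           \<le> a * exp (- 2 * pi * X * \<delta>) * exp (- 2 * pi * \<delta>) ^ n" (is ?step)
proof -
  define b where "b = drift_error a X \<delta>"
  define r where "r = exp (- 2 * pi * \<delta>)"
  define F where "F = (\<lambda>n. (wave_map a ^^ n) z)"
  have \<delta>: "\<delta> > 0" "X \<ge> 0" and b: "b \<le> \<delta> / 2" "b \<le> 1"
    using tame by (auto simp: tame_def b_def)
  have r: "0 < r" "r < 1" using \<delta> by (auto simp: r_def)
  have b_r: "b * (1 - r) = a * exp (- 2 * pi * X * \<delta>)"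
    using r unfolding b_def drift_error_def r_def[symmetric] by simp
  have "0 \<le> b" unfolding b_def drift_error_def using r a by (simp add: r_def)
  have step: "norm (F (Suc n) - F n - of_real a) \<le> a * exp (- 2 * pi * X * \<delta>) * r ^ n"
    if bd: "norm (F n - z - of_nat n * of_real a) \<le> b * (1 - r ^ n)" for n
  proof -
    have "1 - r ^ n \<le> 1" using r by simp
    from mult_left_mono[OF this \<open>0 \<le> b\<close>] have close: "norm (F n - z - of_nat n * of_real a) \<le> b" using bd by simp
    have Im_F: "Im (F n) \<ge> \<delta> / 2"
      using abs_Im_le_cmod[of "F n - z - of_nat n * of_real a"] close b z by simp
    have Re_F: "Re (F n) \<ge> X + real n"
    proof (cases "n = 0")
      case True
      then show ?thesis using z by (simp add: F_def)
    next
      case False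
      have "real n * a \<ge> real n * 2" using a by (intro mult_left_mono) auto
      moreover have "Re (F n) \<ge> Re z + real n * a - b"
        using abs_Re_le_cmod[of "F n - z - of_nat n * of_real a"] close by simp
      moreover have "real n \<ge> 1" using False by simp
      ultimately show ?thesis using z b by linarith
    qed
    have "(X + real n) * (\<delta> / 2) \<le> Re (F n) * Im (F n)"
      using Im_F Re_F \<delta> by (intro mult_mono) auto
    then have "4 * pi * ((X + real n) * (\<delta> / 2)) \<le> 4 * pi * (Re (F n) * Im (F n))"
      by (intro mult_left_mono) auto
    then have "norm (wave (F n)) \<le> exp (- 4 * pi * ((X + real n) * (\<delta> / 2)))"
      unfolding norm_wave exp_le_cancel_iff by (simp add: mult.assoc)
    also have "\<dots> = exp (- 2 * pi * X * \<delta> + real n * (- 2 * pi * \<delta>))"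
      by (simp add: field_simps)
    also have "\<dots> = exp (- 2 * pi * X * \<delta>) * r ^ n"
      unfolding exp_add r_def by (simp only: exp_of_nat_mult)
    finally have "a * norm (wave (F n)) \<le> a * (exp (- 2 * pi * X * \<delta>) * r ^ n)"
      using a by (intro mult_left_mono) auto
    moreover have "F (Suc n) - F n - of_real a = - (of_real a * wave (F n))"
      by (simp add: F_def wave_map_def algebra_simps)
    ultimately show ?thesis using a by (simp add: norm_mult mult.assoc)
  qed
  have bound: "norm (F n - z - of_nat n * of_real a) \<le> b * (1 - r ^ n)" for n
  proof (induction n)
    case 0
    then show ?case by (simp add: F_def)
  next
    case (Suc n)
    have "F (Suc n) - z - of_nat (Suc n) * of_real a =
        (F n - z - of_nat n * of_real a) + (F (Suc n) - F n - of_real a)"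
      by (simp add: algebra_simps)
    then have "norm (F (Suc n) - z - of_nat (Suc n) * of_real a) \<le>
        b * (1 - r ^ n) + a * exp (- 2 * pi * X * \<delta>) * r ^ n"
      using Suc step[OF Suc] norm_triangle_mono by metis
    also have "\<dots> = b * (1 - r ^ Suc n)"
      unfolding b_r[symmetric] by (simp add: algebra_simps)
    finally show ?case .
  qed
  show ?bound using bound[of n] by (simp only: F_def b_def r_def)
  show ?step using step[OF bound] by (simp only: F_def r_def)
qed

lemma orbit_estimate_uniform:
  assumes "a \<ge> 2" "tame a X \<delta>" "z \<in> quadrant X \<delta>"
  shows "norm ((wave_map a ^^ n) z - of_nat n * of_real a - z) \<le> drift_error a X \<delta>"
proof -
  have \<delta>: "\<delta> > 0" using assms by (simp add: tame_def)
  have "0 \<le> drift_error a X \<delta>" using assms \<delta> by (simp add: drift_error_def)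
  then have "drift_error a X \<delta> * (1 - exp (- 2 * pi * \<delta>) ^ n) \<le> drift_error a X \<delta> * 1"
    by (intro mult_left_mono) auto
  moreover have "norm ((wave_map a ^^ n) z - z - of_nat n * of_real a)
      \<le> drift_error a X \<delta> * (1 - exp (- 2 * pi * \<delta>) ^ n)"
    by (rule orbit_estimate(1)) (use assms in \<open>auto simp: quadrant_def\<close>)
  ultimately have "norm ((wave_map a ^^ n) z - z - of_nat n * of_real a) \<le> drift_error a X \<delta>"
    by linarith
  moreover have "(wave_map a ^^ n) z - z - of_nat n * of_real a =
      (wave_map a ^^ n) z - of_nat n * of_real a - z" by simp
  ultimately show ?thesis by metis
qed

lemma open_quadrant: "open (quadrant X \<delta>)"
  unfolding quadrant_def by (intro open_Collect_conj open_Collect_less continuous_intros)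

lemma convex_quadrant: "convex (quadrant X \<delta>)"
proof -
  have "quadrant X \<delta> = {z. Re z > X} \<inter> {z. Im z > \<delta>}" by (auto simp: quadrant_def)
  then show ?thesis by (simp add: convex_Int convex_halfspace_Re_gt convex_halfspace_Im_gt)
qed

lemma quadrant_subset_drift_set:
  assumes "a \<ge> 2" "tame a X \<delta>"
  shows "quadrant X \<delta> \<subseteq> drift_set (wave_map a) a"
proof
  fix z assume "z \<in> quadrant X \<delta>"
  then obtain r where r: "r > 0" "ball z r \<subseteq> quadrant X \<delta>"
    using open_quadrant openE by blast
  have "norm ((wave_map a ^^ n) w - of_nat n * of_real a) \<le> norm z + r + drift_error a X \<delta>"
    if w: "w \<in> ball z r" for n w
  proof -
    have "norm ((wave_map a ^^ n) w - of_nat n * of_real a - w) \<le> drift_error a X \<delta>"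
      using orbit_estimate_uniform assms w r by blast
    moreover have "norm w \<le> norm z + r"
      using w norm_triangle_sub[of w z] by (simp add: dist_norm norm_minus_commute)
    moreover have "norm ((wave_map a ^^ n) w - of_nat n * of_real a) \<le>
        norm w + norm ((wave_map a ^^ n) w - of_nat n * of_real a - w)"
      by (rule norm_triangle_sub)
    ultimately show ?thesis by linarith
  qed
  then show "z \<in> drift_set (wave_map a) a" unfolding drift_set_def using r(1) by blast
qed

lemma orbit_convergent:
  assumes "a \<ge> 2" "tame a X \<delta>" "z \<in> quadrant X \<delta>"
  shows "convergent (\<lambda>n. (wave_map a ^^ n) z - of_nat n * of_real a)"
proof -
  define G where "G = (\<lambda>n. (wave_map a ^^ n) z - of_nat n * of_real a)"
  have \<delta>: "\<delta> > 0" using assms by (simp add: tame_def)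
  have increment: "norm (G (Suc n) - G n) \<le> a * exp (- 2 * pi * X * \<delta>) * exp (- 2 * pi * \<delta>) ^ n" for n
  proof -
    have "G (Suc n) - G n = (wave_map a ^^ Suc n) z - (wave_map a ^^ n) z - of_real a"
      by (simp add: G_def algebra_simps)
    then show ?thesis
      using orbit_estimate(2)[OF assms(1,2), of z n] assms(3) by (simp add: quadrant_def)
  qed
  have geometric: "summable (\<lambda>n. a * exp (- 2 * pi * X * \<delta>) * exp (- 2 * pi * \<delta>) ^ n)"
    using \<delta> by (intro summable_mult summable_geometric) auto
  have "summable (\<lambda>n. G (Suc n) - G n)"
    by (rule summable_comparison_test'[OF geometric, of 0]) (rule increment)
  then have "convergent (\<lambda>n. \<Sum>k<n. G (Suc k) - G k)"
    by (simp add: summable_iff_convergent)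
  then have "convergent (\<lambda>n. G n - G 0)" by (simp add: sum_lessThan_telescope)
  then have "convergent (\<lambda>n. (G n - G 0) + G 0)" by (intro convergent_add convergent_const)
  then show ?thesis by (simp add: G_def)
qed

lemma tame_exists:
  assumes "\<delta> > 0" "e > 0"
  obtains X where "tame a X \<delta>" "drift_error a X \<delta> < e"
proof -
  have "((\<lambda>X. drift_error a X \<delta>) \<longlongrightarrow> 0) at_top"
  proof -
    have "filterlim (\<lambda>X. X * (2 * pi * \<delta>)) at_top at_top"
      using \<open>\<delta> > 0\<close> by (intro filterlim_at_top_mult_tendsto_pos[OF tendsto_const] filterlim_ident) auto
    then have "((\<lambda>X. exp (- (X * (2 * pi * \<delta>)))) \<longlongrightarrow> 0) at_top"
      by (intro filterlim_compose[OF exp_at_bot]) (simp add: filterlim_uminus_at_top[symmetric])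
    then have "((\<lambda>X. a * exp (- (X * (2 * pi * \<delta>))) / (1 - exp (- 2 * pi * \<delta>))) \<longlongrightarrow>
        a * 0 / (1 - exp (- 2 * pi * \<delta>))) at_top"
      using \<open>\<delta> > 0\<close> by (intro tendsto_intros) auto
    then show ?thesis unfolding drift_error_def by (simp add: mult_ac)
  qed
  then have "\<forall>\<^sub>F X in at_top. drift_error a X \<delta> < min (min (\<delta> / 2) 1) e"
    using assms by (intro order_tendstoD) auto
  moreover have "\<forall>\<^sub>F X in at_top. (0::real) \<le> X" by (rule eventually_ge_at_top)
  ultimately have "\<forall>\<^sub>F X in at_top. 0 \<le> X \<and> drift_error a X \<delta> < min (min (\<delta> / 2) 1) e"
    by eventually_elim simp
  then obtain X where "0 \<le> X \<and> drift_error a X \<delta> < min (min (\<delta> / 2) 1) e"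
    using eventually_happens trivial_limit_at_top_linorder by blast
  then show ?thesis using that[of X] \<open>\<delta> > 0\<close> by (simp add: tame_def)
qed

section \<open>Perturbations of the identity\<close>

text \<open>If \<open>\<phi>\<close> differs from the identity by less than \<open>\<rho> / 8\<close> on a disc of radius \<open>\<rho>\<close>, the Cauchy estimate on
  discs of radius \<open>\<rho> / 4\<close> makes the difference a contraction with constant 1/2 on the concentric disc
  of radius \<open>\<rho> / 2\<close>. The centre is a value by Brouwer's theorem applied to \<open>z \<mapsto> c - (\<phi> z - z)\<close>.\<close>

lemma near_identity_on_ball:
  fixes \<phi> :: "complex \<Rightarrow> complex"
  assumes hol: "\<phi> holomorphic_on ball c \<rho>" and "\<rho> > 0"
    and near: "\<And>z. z \<in> ball c \<rho> \<Longrightarrow> norm (\<phi> z - z) < \<rho> / 8"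
  shows "inj_on \<phi> (ball c (\<rho> / 2))" and "c \<in> \<phi> ` ball c (\<rho> / 2)"
proof -
  define d where "d = (\<lambda>z. \<phi> z - z)"
  have hold: "d holomorphic_on ball c \<rho>"
    unfolding d_def by (intro holomorphic_intros hol)
  have der: "norm (deriv d x) \<le> 1 / 2" if x: "x \<in> ball c (\<rho> / 2)" for x
  proof -
    have sub: "cball x (\<rho> / 4) \<subseteq> ball c \<rho>"
    proof
      fix y assume "y \<in> cball x (\<rho> / 4)"
      then show "y \<in> ball c \<rho>" using x \<open>\<rho> > 0\<close> dist_triangle[of c y x] by simp
    qed
    have "norm ((deriv ^^ 1) d x) \<le> fact 1 * (\<rho> / 8) / (\<rho> / 4) ^ 1"
    proof (rule Cauchy_higher_deriv_bound)
      show "d holomorphic_on ball x (\<rho> / 4)"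
        using hold sub ball_subset_cball holomorphic_on_subset by blast
      show "continuous_on (cball x (\<rho> / 4)) d"
        using hold sub holomorphic_on_subset holomorphic_on_imp_continuous_on by blast
      show "d w \<in> ball 0 (\<rho> / 8)" if "w \<in> ball x (\<rho> / 4)" for w
        using near[of w] sub that by (auto simp: d_def subset_iff)
    qed (use \<open>\<rho> > 0\<close> in auto)
    then show ?thesis using \<open>\<rho> > 0\<close> by simp
  qed
  have has_der: "(d has_field_derivative deriv d x) (at x within ball c (\<rho> / 2))"
    if "x \<in> ball c (\<rho> / 2)" for x
    by (rule holomorphic_derivI[OF hold open_ball]) (use that \<open>\<rho> > 0\<close> in auto)
  show "inj_on \<phi> (ball c (\<rho> / 2))"
  proof (rule inj_onI)
    fix x y assume xy: "x \<in> ball c (\<rho> / 2)" "y \<in> ball c (\<rho> / 2)" "\<phi> x = \<phi> y"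
    have "norm (d x - d y) \<le> 1 / 2 * norm (x - y)"
      by (rule field_differentiable_bound[of "ball c (\<rho> / 2)" d "deriv d"])
         (use xy der has_der in auto)
    moreover have "norm (d x - d y) = norm (x - y)"
      using xy(3) by (simp add: d_def norm_minus_commute)
    ultimately show "x = y" by simp
  qed
  have "continuous_on (cball c (\<rho> / 4)) (\<lambda>z. c - d z)"
  proof (intro continuous_intros)
    have "cball c (\<rho> / 4) \<subseteq> ball c \<rho>" using \<open>\<rho> > 0\<close> by auto
    then show "continuous_on (cball c (\<rho> / 4)) d"
      using hold holomorphic_on_subset holomorphic_on_imp_continuous_on by blast
  qed
  moreover have "(\<lambda>z. c - d z) \<in> cball c (\<rho> / 4) \<rightarrow> cball c (\<rho> / 4)"
  proof
    fix z assume "z \<in> cball c (\<rho> / 4)"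
    then have "norm (d z) < \<rho> / 8" using near[of z] \<open>\<rho> > 0\<close> by (simp add: d_def)
    then show "c - d z \<in> cball c (\<rho> / 4)" using \<open>\<rho> > 0\<close> by (simp add: dist_norm)
  qed
  ultimately obtain x where x: "x \<in> cball c (\<rho> / 4)" "c - d x = x"
    using brouwer_ball[of "\<rho> / 4" c "\<lambda>z. c - d z"] \<open>\<rho> > 0\<close> by auto
  then have "\<phi> x = c" "x \<in> ball c (\<rho> / 2)" using \<open>\<rho> > 0\<close> by (auto simp: d_def algebra_simps)
  then show "c \<in> \<phi> ` ball c (\<rho> / 2)" by blast
qed

section \<open>Limit coordinate on an invariant domain\<close>

lemma Re_iterates_at_top:
  assumes "(\<lambda>n. (f ^^ n) z - of_nat n * of_real a) \<longlonglongrightarrow> l" "a > 0"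
  shows "filterlim (\<lambda>n. Re ((f ^^ n) z)) at_top sequentially"
proof -
  have "(\<lambda>n. Re ((f ^^ n) z - of_nat n * of_real a)) \<longlonglongrightarrow> Re l"
    using assms(1) by (rule tendsto_Re)
  moreover have "filterlim (\<lambda>n. a * real n) at_top sequentially"
    using \<open>a > 0\<close> by (intro filterlim_tendsto_pos_mult_at_top[OF tendsto_const] filterlim_real_sequentially)
  ultimately have "filterlim (\<lambda>n. Re ((f ^^ n) z - of_nat n * of_real a) + a * real n) at_top sequentially"
    by (rule filterlim_tendsto_add_at_top)
  then show ?thesis by (simp add: algebra_simps)
qed

text \<open>The limit \<open>\<phi>\<close> of \<open>f\<^sup>n - n a\<close> maps \<open>U\<close> into the upper half-plane because the factor \<open>w\<close> has modulus
  at least 1 at points with positive real part and nonpositive imaginary part, and \<open>w\<close> tends to 0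
  along the orbits in \<open>U\<close>.\<close>

lemma simply_parabolic_wave_map:
  assumes a: "a \<ge> 2"
    and U: "open U" "connected U" "U \<subseteq> drift_set (wave_map a) a" "wave_map a ` U \<subseteq> U"
    and quad: "\<And>X \<delta>. tame a X \<delta> \<Longrightarrow> quadrant X \<delta> \<subseteq> U"
  shows "simply_parabolic (wave_map a) U"
proof -
  define f where "f = wave_map a"
  define G where "G = (\<lambda>n z. (f ^^ n) z - of_nat n * of_real a)"
  have hol_f: "f holomorphic_on S" for S by (simp add: f_def holomorphic_wave_map)
  have funpow_U: "(f ^^ n) u \<in> U" if "u \<in> U" for n u
    using that U(4) by (induction n) (auto simp: f_def)

  \<comment> \<open>Any single quadrant will do as the open set on which convergence is known.\<close>
  obtain X1 where X1: "tame a X1 1" using tame_exists[of 1 1 a] by auto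
  have "G n holomorphic_on U" for n
    unfolding G_def by (intro holomorphic_intros hol_f)
  moreover have "\<exists>B. \<forall>n. \<forall>z\<in>K. norm (G n z) \<le> B" if "compact K" "K \<subseteq> U" for K
    using drift_set_compact_bound[of K f a] that U(3) unfolding G_def f_def by blast
  moreover have "Complex (X1 + 1) 2 \<in> quadrant X1 1" by (simp add: quadrant_def)
  then have "quadrant X1 1 \<noteq> {}" by blast
  moreover have "convergent (\<lambda>n. G n z)" if "z \<in> quadrant X1 1" for z
    using orbit_convergent[OF a X1 that] by (simp add: G_def f_def)
  ultimately obtain \<phi> where hol: "\<phi> holomorphic_on U" and lim: "\<And>z. z \<in> U \<Longrightarrow> (\<lambda>n. G n z) \<longlonglongrightarrow> \<phi> z"
    using Vitali_convergence[OF U(1,2), of G "quadrant X1 1"] open_quadrant quad[OF X1] by metis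

  have conj: "\<phi> (f u) = \<phi> u + of_real a" if u: "u \<in> U" for u
  proof -
    have "(\<lambda>n. G (Suc n) u) \<longlonglongrightarrow> \<phi> u" using lim[OF u] by (rule LIMSEQ_Suc)
    then have "(\<lambda>n. G (Suc n) u + of_real a) \<longlonglongrightarrow> \<phi> u + of_real a" by (intro tendsto_intros)
    moreover have "G (Suc n) u + of_real a = G n (f u)" for n
      by (simp add: G_def funpow_swap1 algebra_simps)
    ultimately have "(\<lambda>n. G n (f u)) \<longlonglongrightarrow> \<phi> u + of_real a" by simp
    moreover have "f u \<in> U" using funpow_U[of u 1] u by simp
    ultimately show ?thesis using lim LIMSEQ_unique by blast
  qed
  have conj_funpow: "\<phi> ((f ^^ n) u) = \<phi> u + of_nat n * of_real a" if "u \<in> U" for n u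
    using that by (induction n) (simp_all add: conj funpow_U algebra_simps)

  have near: "norm (\<phi> z - z) \<le> drift_error a X \<delta>" if t: "tame a X \<delta>" and z: "z \<in> quadrant X \<delta>" for X \<delta> z
  proof -
    have "(\<lambda>n. norm (G n z - z)) \<longlonglongrightarrow> norm (\<phi> z - z)"
      using lim[of z] quad[OF t] z by (intro tendsto_intros) auto
    moreover have "norm (G n z - z) \<le> drift_error a X \<delta>" for n
      unfolding G_def f_def by (rule orbit_estimate_uniform[OF a t z])
    ultimately show ?thesis by (intro LIMSEQ_le_const2) auto
  qed

  have Re_top: "filterlim (\<lambda>n. Re ((f ^^ n) u)) at_top sequentially" if "u \<in> U" for u
    using Re_iterates_at_top[of f u a] lim[OF that] a unfolding G_def by auto
  have Im_lim: "(\<lambda>n. Im ((f ^^ n) u)) \<longlonglongrightarrow> Im (\<phi> u)" if "u \<in> U" for u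
    using tendsto_Im[OF lim[OF that]] by (simp add: G_def)

  have Im_nonneg: "0 \<le> Im (\<phi> u)" if u: "u \<in> U" for u
  proof -
    have "(\<lambda>n. G n u - G (Suc n) u) \<longlonglongrightarrow> \<phi> u - \<phi> u"
      using lim[OF u] by (intro tendsto_diff LIMSEQ_Suc)
    moreover have "G n u - G (Suc n) u = of_real a * wave ((f ^^ n) u)" for n
      by (simp add: G_def f_def wave_map_def algebra_simps)
    ultimately have "(\<lambda>n. of_real a * wave ((f ^^ n) u)) \<longlonglongrightarrow> 0" by simp
    then have "(\<lambda>n. of_real a * wave ((f ^^ n) u) / of_real a) \<longlonglongrightarrow> 0 / of_real a"
      using a by (intro tendsto_divide tendsto_const) auto
    then have "(\<lambda>n. norm (wave ((f ^^ n) u))) \<longlonglongrightarrow> norm (0::complex)"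
      using a by (intro tendsto_norm) simp
    then have "\<forall>\<^sub>F n in sequentially. norm (wave ((f ^^ n) u)) < 1"
      by (intro order_tendstoD) auto
    moreover have "\<forall>\<^sub>F n in sequentially. 0 < Re ((f ^^ n) u)"
      using Re_top[OF u] by (simp add: filterlim_at_top_dense)
    ultimately have "\<forall>\<^sub>F n in sequentially. 0 \<le> Im ((f ^^ n) u)"
    proof eventually_elim
      case (elim n)
      then have "0 < Re ((f ^^ n) u) * Im ((f ^^ n) u)"
        by (simp add: norm_wave mult_ac zero_less_mult_iff)
      then show ?case using elim by (simp add: zero_less_mult_iff)
    qed
    then show ?thesis using Im_lim[OF u] by (intro tendsto_lowerbound) auto
  qed
  have "\<not> \<phi> constant_on U"
  proof
    assume c: "\<phi> constant_on U"
    have p: "Complex (X1 + 1) 2 \<in> U" using quad[OF X1] by (auto simp: quadrant_def)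
    then have "\<phi> (f (Complex (X1 + 1) 2)) = \<phi> (Complex (X1 + 1) 2)"
      using c funpow_U[OF p, of 1] by (auto simp: constant_on_def)
    then show False using conj[OF p] a by simp
  qed
  then have open_image: "open (\<phi> ` U)" by (intro open_mapping_thm[OF hol U(1,2,1)]) auto
  have Im_pos: "0 < Im (\<phi> u)" if u: "u \<in> U" for u
  proof -
    have "\<phi> u \<in> \<phi> ` U" using u by simp
    then obtain e where e: "e > 0" "ball (\<phi> u) e \<subseteq> \<phi> ` U"
      using open_image openE by blast
    have "\<phi> u - \<i> * of_real (e / 2) \<in> ball (\<phi> u) e" using e(1) by (simp add: dist_norm norm_mult)
    then have "\<phi> u - \<i> * of_real (e / 2) \<in> \<phi> ` U" using e(2) by blast
    then obtain v where v: "\<phi> u - \<i> * of_real (e / 2) = \<phi> v" "v \<in> U" by (rule imageE)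
    have "0 \<le> Im (\<phi> u - \<i> * of_real (e / 2))" unfolding v(1) by (rule Im_nonneg[OF v(2)])
    then show ?thesis using e(1) by simp
  qed
  have absorb: "\<forall>\<^sub>F n in sequentially. (f ^^ n) u \<in> quadrant X \<delta>"
    if u: "u \<in> U" and \<delta>: "\<delta> < Im (\<phi> u)" for u X \<delta>
  proof -
    have "\<forall>\<^sub>F n in sequentially. X < Re ((f ^^ n) u)"
      using Re_top[OF u] by (simp add: filterlim_at_top_dense)
    moreover have "\<forall>\<^sub>F n in sequentially. \<delta> < Im ((f ^^ n) u)"
      using Im_lim[OF u] \<delta> by (rule order_tendstoD)
    ultimately show ?thesis by eventually_elim (simp add: quadrant_def)
  qed

  have nice_quadrant: "\<exists>X. tame a X \<delta> \<and>
      (\<forall>c. X + \<delta> < Re c \<longrightarrow> 2 * \<delta> < Im c \<longrightarrow>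
         ball c \<delta> \<subseteq> U \<and> (\<forall>z\<in>ball c \<delta>. norm (\<phi> z - z) < \<delta> / 8))" if "\<delta> > 0" for \<delta>
  proof -
    obtain X where X: "tame a X \<delta>" "drift_error a X \<delta> < \<delta> / 8"
      using tame_exists[of \<delta> "\<delta> / 8" a] \<open>\<delta> > 0\<close> by auto
    have "ball c \<delta> \<subseteq> quadrant X \<delta>" if "X + \<delta> < Re c" "2 * \<delta> < Im c" for c
    proof
      fix z assume "z \<in> ball c \<delta>"
      then have "norm (c - z) < \<delta>" by (simp add: dist_norm)
      then have "Re (c - z) < \<delta>" "Im (c - z) < \<delta>"
        using complex_Re_le_cmod[of "c - z"] abs_Im_le_cmod[of "c - z"] by linarith+
      then show "z \<in> quadrant X \<delta>" using that by (simp add: quadrant_def)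
    qed
    then show ?thesis using X quad[OF X(1)] near[OF X(1)] by (meson le_less_trans subset_iff)
  qed

  \<comment> \<open>If \<open>\<phi> u = \<phi> v\<close>, the \<open>n\<close>-th iterates lie, for large \<open>n\<close>, in a common disc on which \<open>\<phi>\<close> is
      injective, so they coincide.\<close>
  have inj: "\<exists>n. (f ^^ n) u = (f ^^ n) v" if uv: "u \<in> U" "v \<in> U" "\<phi> u = \<phi> v" for u v
  proof -
    define \<delta> where "\<delta> = Im (\<phi> u) / 3"
    have \<delta>: "\<delta> > 0" "2 * \<delta> < Im (\<phi> u)" "2 * \<delta> < Im (\<phi> v)"
      using Im_pos[OF uv(1)] uv(3) by (auto simp: \<delta>_def)
    obtain X where X: "\<And>c. X + \<delta> < Re c \<Longrightarrow> 2 * \<delta> < Im c \<Longrightarrow>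
         ball c \<delta> \<subseteq> U \<and> (\<forall>z\<in>ball c \<delta>. norm (\<phi> z - z) < \<delta> / 8)"
      using nice_quadrant[OF \<delta>(1)] by blast
    have "\<forall>\<^sub>F n in sequentially. (f ^^ n) u \<in> quadrant (X + \<delta>) (2 * \<delta>) \<and>
        (f ^^ n) v \<in> quadrant (X + \<delta>) (2 * \<delta>)"
      using uv \<delta> by (intro eventually_conj absorb) auto
    then obtain n where n: "(f ^^ n) u \<in> quadrant (X + \<delta>) (2 * \<delta>)"
        "(f ^^ n) v \<in> quadrant (X + \<delta>) (2 * \<delta>)"
      using eventually_happens'[OF sequentially_bot] by blast
    define c d where "c = (f ^^ n) u" and "d = (f ^^ n) v"
    have c: "ball c \<delta> \<subseteq> U" "\<And>z. z \<in> ball c \<delta> \<Longrightarrow> norm (\<phi> z - z) < \<delta> / 8"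
      using X[of c] n by (auto simp: c_def quadrant_def)
    have "norm (\<phi> d - d) < \<delta> / 8"
      using X[of d] n \<delta> by (auto simp: d_def quadrant_def)
    moreover have "norm (\<phi> c - c) < \<delta> / 8" using c(2)[of c] \<delta> by simp
    moreover have eq: "\<phi> c = \<phi> d" using uv by (simp add: c_def d_def conj_funpow)
    moreover have "c - d = (\<phi> d - d) - (\<phi> c - c)" using eq by simp
    then have "norm (c - d) \<le> norm (\<phi> d - d) + norm (\<phi> c - c)"
      by (metis norm_triangle_ineq4)
    ultimately have "d \<in> ball c (\<delta> / 2)" using \<delta> by (simp add: dist_norm)
    moreover have "c \<in> ball c (\<delta> / 2)" using \<delta> by simp
    moreover have "inj_on \<phi> (ball c (\<delta> / 2))"
      by (rule near_identity_on_ball(1)) (use c hol \<delta> in \<open>auto intro: holomorphic_on_subset\<close>)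
    ultimately have "c = d" using eq by (auto dest: inj_onD)
    then show ?thesis by (auto simp: c_def d_def)
  qed

  \<comment> \<open>Translating \<open>a w\<close> far to the right brings it into a region where \<open>\<phi>\<close> is close to the identity
      and can be inverted.\<close>
  have sect: "\<exists>N g n. open N \<and> w \<in> N \<and> g holomorphic_on N \<and> g ` N \<subseteq> U \<and>
      (\<forall>z\<in>N. \<phi> (g z) / of_real a = z + of_nat n)" if w: "0 < Im w" for w
  proof -
    define \<delta> where "\<delta> = a * Im w / 3"
    have \<delta>: "\<delta> > 0" "2 * \<delta> < a * Im w" using w a by (auto simp: \<delta>_def)
    obtain X where X: "\<And>c. X + \<delta> < Re c \<Longrightarrow> 2 * \<delta> < Im c \<Longrightarrow>
         ball c \<delta> \<subseteq> U \<and> (\<forall>z\<in>ball c \<delta>. norm (\<phi> z - z) < \<delta> / 8)"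
      using nice_quadrant[OF \<delta>(1)] by blast
    obtain n :: nat where "(X + \<delta>) / a - Re w < real n" using reals_Archimedean2 by blast
    then have n: "X + \<delta> < a * (Re w + real n)" using a by (simp add: field_simps)
    define c where "c = of_real a * (w + of_nat n)"
    define B where "B = ball c (\<delta> / 2)"
    have c: "ball c \<delta> \<subseteq> U" "\<And>z. z \<in> ball c \<delta> \<Longrightarrow> norm (\<phi> z - z) < \<delta> / 8"
      using X[of c] n \<delta> by (auto simp: c_def)
    have hol_ball: "\<phi> holomorphic_on ball c \<delta>" using c(1) hol holomorphic_on_subset by blast
    have B: "B \<subseteq> U" "\<phi> holomorphic_on B" "open B"
      using c(1) hol \<delta>(1) by (auto simp: B_def subset_iff intro!: holomorphic_on_subset[OF hol_ball])
    have injB: "inj_on \<phi> B" and cB: "c \<in> \<phi> ` B"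
      unfolding B_def using near_identity_on_ball[OF hol_ball \<delta>(1) c(2)] by auto
    obtain g where g: "g holomorphic_on (\<phi> ` B)" "\<And>z. z \<in> B \<Longrightarrow> g (\<phi> z) = z"
      using holomorphic_has_inverse[OF B(2,3) injB] by metis
    define s where "s = (\<lambda>z. of_real a * (z + of_nat n) :: complex)"
    define N where "N = s -` (\<phi> ` B)"
    have "open (\<phi> ` B)" by (rule open_mapping_thm3[OF B(2,3) injB])
    then have "open N" unfolding N_def s_def
      by (intro open_vimage continuous_intros)
    moreover have "w \<in> N" using cB by (simp add: N_def s_def c_def)
    moreover have "g \<circ> s holomorphic_on N"
      by (rule holomorphic_on_compose_gen[OF _ g(1)])
         (auto simp: N_def s_def intro!: holomorphic_intros)
    moreover have "(g \<circ> s) z \<in> U \<and> \<phi> ((g \<circ> s) z) / of_real a = z + of_nat n" if "z \<in> N" for z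
    proof -
      obtain x where x: "x \<in> B" "s z = \<phi> x" using \<open>z \<in> N\<close> by (auto simp: N_def)
      then have "(g \<circ> s) z = x" by (simp add: g(2))
      then show ?thesis using x B(1) a by (auto simp: s_def x(2)[symmetric])
    qed
    ultimately show ?thesis by (intro exI[of _ N] exI[of _ "g \<circ> s"] exI[of _ n]) auto
  qed

  show ?thesis
  proof (fold f_def, rule simply_parabolicI[where \<psi> = "\<lambda>z. \<phi> z / of_real a"])
    show "f ` U \<subseteq> U" using U(4) by (simp add: f_def)
    show "(\<lambda>z. \<phi> z / of_real a) holomorphic_on U"
      using a by (intro holomorphic_intros hol) auto
    show "0 < Im (\<phi> u / of_real a)" if "u \<in> U" for u using Im_pos[OF that] a by simp
    show "\<phi> (f u) / of_real a = \<phi> u / of_real a + 1" if "u \<in> U" for u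
      using conj[OF that] a by (simp add: add_divide_distrib)
    show "\<exists>n. (f ^^ n) u = (f ^^ n) v"
      if "u \<in> U" "v \<in> U" "\<phi> u / of_real a = \<phi> v / of_real a" for u v
      using inj that a by simp
  qed (use U(1) sect in auto)
qed

section \<open>A critical point in the Baker domain\<close>

text \<open>The derivative of the map vanishes at \<open>z\<close> iff \<open>4 \<pi> a \<i> z exp (2 \<pi> \<i> z\<^sup>2) = 1\<close>. At \<open>z = 1 + \<i> / \<surd>3\<close> the
  arguments of \<open>\<i> z\<close> and of the exponential are \<open>2 \<pi> / 3\<close> and \<open>4 \<pi> / 3\<close>, so the product is positive and
  the equation determines a positive real number \<open>a\<close>.\<close>

definition critical_shift :: real where
  "critical_shift = sqrt 3 * exp (4 * pi / sqrt 3) / (8 * pi)"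

definition critical_point :: complex where
  "critical_point = Complex 1 (1 / sqrt 3)"

lemma sqrt3_bounds: "3 / 2 \<le> sqrt 3" "sqrt 3 \<le> 2"
  by (rule real_le_rsqrt real_le_lsqrt; simp add: power2_eq_square)+

lemma two_pow_le_exp: "2 ^ n \<le> exp (real n)"
proof -
  have "2 \<le> exp (1::real)" using exp_ge_add_one_self[of 1] by simp
  then have "2 ^ n \<le> exp (1::real) ^ n" by (intro power_mono) auto
  then show ?thesis by (simp add: exp_of_nat_mult[symmetric])
qed

lemma critical_shift_ge_3: "3 \<le> critical_shift"
proof -
  have "6 * sqrt 3 \<le> 4 * pi" using sqrt3_bounds pi_gt3 by linarith
  then have "6 \<le> 4 * pi / sqrt 3" by (simp add: pos_le_divide_eq)
  then have "exp 6 \<le> exp (4 * pi / sqrt 3)" by simp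
  moreover have "(64::real) \<le> exp 6" using two_pow_le_exp[of 6] by simp
  ultimately have "64 \<le> exp (4 * pi / sqrt 3)" by linarith
  then have "3 / 2 * 64 \<le> sqrt 3 * exp (4 * pi / sqrt 3)"
    using sqrt3_bounds by (intro mult_mono) auto
  moreover have "3 * (8 * pi) \<le> 3 / 2 * 64" using pi_less_4 by simp
  ultimately have "3 * (8 * pi) \<le> sqrt 3 * exp (4 * pi / sqrt 3)" by linarith
  then show ?thesis unfolding critical_shift_def by (simp add: pos_le_divide_eq)
qed

lemma deriv_wave_map:
  "(wave_map a has_field_derivative 1 - of_real a * (4 * of_real pi * \<i> * z * wave z)) (at z)"
  unfolding wave_map_def wave_def by (auto intro!: derivative_eq_intros)

lemma deriv_wave_map_critical_point: "deriv (wave_map critical_shift) critical_point = 0"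
proof -
  define E where "E = exp (- (4 * pi / sqrt 3))"
  have "2 * of_real pi * \<i> * critical_point\<^sup>2 = Complex (- (4 * pi / sqrt 3)) (2 * (2 * pi / 3))"
    by (simp add: critical_point_def complex_eq_iff power2_eq_square field_simps)
  then have "wave critical_point = of_real E * cis (2 * (2 * pi / 3))"
    by (simp add: wave_def exp_eq_polar E_def)
  moreover have "cis (2 * (2 * pi / 3)) = Complex (- 1 / 2) (- sqrt 3 / 2)"
  proof -
    have "cos (2 * (2 * pi / 3)) = - 1 / 2" "sin (2 * (2 * pi / 3)) = - sqrt 3 / 2"
      using cos_120 sin_120 by (simp_all only: cos_double sin_double) (simp_all add: power2_eq_square)
    then show ?thesis by (simp add: complex_eq_iff)
  qed
  ultimately have wave_crit: "wave critical_point = of_real E * Complex (- 1 / 2) (- sqrt 3 / 2)" by simp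
  have i_crit: "\<i> * critical_point = of_real (2 / sqrt 3) * Complex (- 1 / 2) (sqrt 3 / 2)"
    by (simp add: critical_point_def complex_eq_iff)
  have unit: "Complex (- 1 / 2) (sqrt 3 / 2) * Complex (- 1 / 2) (- sqrt 3 / 2) = 1"
    by (simp add: complex_eq_iff)
  have "of_real critical_shift * (4 * of_real pi * \<i> * critical_point * wave critical_point) =
      of_real critical_shift * (4 * of_real pi) * ((\<i> * critical_point) * wave critical_point)"
    by (simp only: mult_ac)
  also have "\<dots> = of_real (critical_shift * (4 * pi) * (2 / sqrt 3) * E) *
      (Complex (- 1 / 2) (sqrt 3 / 2) * Complex (- 1 / 2) (- sqrt 3 / 2))"
    unfolding wave_crit i_crit by (simp only: of_real_mult of_real_numeral mult_ac)
  also have "critical_shift * (4 * pi) * (2 / sqrt 3) * E = 1"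
    by (simp add: critical_shift_def E_def exp_minus field_simps)
  finally have "of_real critical_shift * (4 * of_real pi * \<i> * critical_point * wave critical_point) = 1"
    unfolding unit by simp
  then show ?thesis using DERIV_imp_deriv[OF deriv_wave_map] by simp
qed

text \<open>The quadrant entered after one step from the closed quadrant with corner at the critical point.\<close>

lemma tame_critical_shift: "tame critical_shift critical_shift (1 / 3)"
proof -
  define a where "a = critical_shift"
  have a: "3 \<le> a" using critical_shift_ge_3 by (simp add: a_def)
  have e3: "exp (- 2 * pi * (1/3)) \<le> (1/4 :: real)"
  proof -
    have "exp (- 2 * pi * (1/3)) \<le> exp (- 2 :: real)" using pi_gt3 by simp
    also have "\<dots> \<le> 1/4" using two_pow_le_exp[of 2] by (simp add: exp_minus field_simps)
    finally show ?thesis .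
  qed
  have "a * exp (- 2 * pi * a * (1/3)) \<le> 1 / 12"
  proof -
    have "2 * a \<le> (1 + a / 2) ^ 2"
      using sum_squares_ge_zero[of "1 - a / 2" 0] by (simp add: power2_eq_square algebra_simps)
    also have "\<dots> \<le> exp (a / 2) ^ 2"
      using a by (intro power_mono exp_ge_add_one_self) auto
    also have "\<dots> = exp a" by (simp add: exp_double[symmetric])
    finally have "2 * a \<le> exp a" .
    then have "2 * a * (2 * a) \<le> exp a * exp a" using a by (intro mult_mono) auto
    moreover have "12 * a \<le> 2 * a * (2 * a)" using a by simp
    ultimately have "12 * a \<le> exp (2 * a)" by (simp add: exp_double power2_eq_square)
    also have "\<dots> \<le> exp (2 * pi * a * (1/3))" using pi_gt3 a by simp
    finally show ?thesis by (simp add: exp_minus field_simps)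
  qed
  then have "drift_error a a (1/3) \<le> (1/12) / (3/4)"
    unfolding drift_error_def using e3 a by (intro frac_le) auto
  then show ?thesis using a by (simp add: tame_def a_def)
qed

text \<open>In this closed quadrant \<open>a exp (2 \<pi> \<i> z\<^sup>2)\<close> has its largest modulus at the corner, and there it is
  \<open>\<surd>3 / (8 \<pi>) \<le> 1 / 12\<close>.\<close>

lemma critical_quadrant_image:
  assumes "1 \<le> Re z" "1 / sqrt 3 \<le> Im z"
  shows "wave_map critical_shift z \<in> quadrant critical_shift (1 / 3)"
proof -
  have s3: "1 / 2 \<le> 1 / sqrt 3" using sqrt3_bounds by (simp add: field_simps)
  have "1 * (1 / sqrt 3) \<le> Re z * Im z" using assms s3 by (intro mult_mono) auto
  then have "4 * pi * (1 / sqrt 3) \<le> 4 * pi * (Re z * Im z)" by (intro mult_left_mono) auto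
  then have "norm (wave z) \<le> exp (- (4 * pi / sqrt 3))"
    unfolding norm_wave exp_le_cancel_iff by (simp add: mult.assoc)
  then have "norm (of_real critical_shift * wave z) \<le> critical_shift * exp (- (4 * pi / sqrt 3))"
    using critical_shift_ge_3 by (simp add: norm_mult mult_left_mono)
  also have "\<dots> = sqrt 3 / (8 * pi)" by (simp add: critical_shift_def exp_minus)
  also have "\<dots> \<le> 2 / (8 * 3)" using sqrt3_bounds pi_gt3 by (intro frac_le) auto
  finally have "norm (of_real critical_shift * wave z) \<le> 1 / 12" by simp
  then have "\<bar>Re (of_real critical_shift * wave z)\<bar> \<le> 1 / 12" "\<bar>Im (of_real critical_shift * wave z)\<bar> \<le> 1 / 12"
    using abs_Re_le_cmod abs_Im_le_cmod order_trans by blast+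
  moreover have map_eq: "wave_map critical_shift z = z + of_real critical_shift - of_real critical_shift * wave z"
    by (simp add: wave_map_def algebra_simps)
  moreover have "Re (wave_map critical_shift z) = Re z + critical_shift - Re (of_real critical_shift * wave z)"
      "Im (wave_map critical_shift z) = Im z - Im (of_real critical_shift * wave z)"
    by (simp_all add: map_eq)
  ultimately have "critical_shift < Re (wave_map critical_shift z)" "1 / 3 < Im (wave_map critical_shift z)"
    using assms s3 by linarith+
  then show ?thesis by (simp add: quadrant_def)
qed

theorem theorem1p1:
  "\<exists>(f :: complex \<Rightarrow> complex) (U :: complex set).
     f holomorphic_on UNIV \<and> invariant_baker_domain f U \<and>
     simply_parabolic f U \<and> \<not> inj_on f U"
proof -
  define f where "f = wave_map critical_shift"
  define U where "U = connected_component_set (fatou_set f) critical_point"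
  \<comment> \<open>\<open>D\<close> connects the critical point with all the quadrants inside the Fatou set.\<close>
  define D where "D = {z. 1 \<le> Re z \<and> 1 / sqrt 3 \<le> Im z}"
  have a: "2 \<le> critical_shift" "0 < critical_shift" using critical_shift_ge_3 by auto
  have hol: "f holomorphic_on S" for S by (simp add: f_def holomorphic_wave_map)
  have drift_fatou: "drift_set f critical_shift \<subseteq> fatou_set f"
    by (rule drift_set_subset_fatou_set[OF hol a(2)])
  have "D \<subseteq> drift_set f critical_shift"
  proof
    fix z assume "z \<in> D"
    then have "f z \<in> quadrant critical_shift (1 / 3)" using critical_quadrant_image by (simp add: D_def f_def)
    then have "f z \<in> drift_set f critical_shift"
      using quadrant_subset_drift_set[OF a(1) tame_critical_shift] by (auto simp: f_def)
    then show "z \<in> drift_set f critical_shift" by (rule drift_set_preimage[OF hol])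
  qed
  moreover have crit_D: "critical_point \<in> D" by (simp add: critical_point_def D_def)
  ultimately have crit_drift: "critical_point \<in> drift_set f critical_shift" and D_fatou: "D \<subseteq> fatou_set f"
    using drift_fatou by auto
  have comp: "U \<in> components (fatou_set f)"
    using crit_D D_fatou by (auto simp: components_def U_def)
  have crit_U: "critical_point \<in> U" using crit_D D_fatou by (auto simp: U_def)
  have "D = {z. 1 \<le> Re z} \<inter> {z. 1 / sqrt 3 \<le> Im z}" by (auto simp: D_def)
  then have "convex D"
    using convex_Int[OF convex_halfspace_Re_ge convex_halfspace_Im_ge] by metis
  then have D_U: "D \<subseteq> U"
    unfolding U_def using connected_component_maximal[OF crit_D convex_connected D_fatou] by blast
  have U_drift: "U \<subseteq> drift_set f critical_shift"
    using fatou_component_subset_drift_set[OF hol _ a(2) comp crit_U crit_drift]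
    by (simp add: f_def wave_map_of_int)
  have "open U" unfolding U_def by (intro open_connected_component open_fatou_set)
  have "connected U" unfolding U_def by simp
  have quad: "quadrant X \<delta> \<subseteq> U" if "tame critical_shift X \<delta>" for X \<delta>
  proof (rule components_maximal[OF comp])
    show "connected (quadrant X \<delta>)" by (intro convex_connected convex_quadrant)
    show "quadrant X \<delta> \<subseteq> fatou_set f"
      using quadrant_subset_drift_set[OF a(1) that] drift_fatou by (auto simp: f_def)
    have "Complex (max X 1 + 1) (max \<delta> (1 / sqrt 3) + 1) \<in> D \<inter> quadrant X \<delta>"
      by (auto simp: D_def quadrant_def)
    then show "U \<inter> quadrant X \<delta> \<noteq> {}" using D_U by blast
  qed
  have fU: "f ` U \<subseteq> U"
  proof (rule components_maximal[OF comp])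
    show "connected (f ` U)"
      using connected_continuous_image[OF holomorphic_on_imp_continuous_on[OF hol] \<open>connected U\<close>] .
    have "f ` U \<subseteq> drift_set f critical_shift"
      using U_drift drift_set_image[OF hol] not_constant_wave_map by (auto simp: f_def)
    then show "f ` U \<subseteq> fatou_set f" using drift_fatou by blast
    have "f critical_point \<in> quadrant critical_shift (1 / 3)"
      using critical_quadrant_image crit_D by (simp add: D_def f_def)
    then show "U \<inter> f ` U \<noteq> {}" using quad[OF tame_critical_shift] crit_U by blast
  qed
  have "invariant_baker_domain f U"
    unfolding invariant_baker_domain_def baker_domain_def
  proof (intro conjI)
    show "transcendental_entire f"
      using transcendental_entire_wave_map a by (simp add: f_def)
    show "tends_to_infinity_locally_uniformly (\<lambda>n. f ^^ n) U"
      using drift_set_tendsto_infinity[OF U_drift a(2)] .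
    show "\<exists>p\<ge>1. (f ^^ p) ` U \<subseteq> U" using fU by (intro exI[of _ 1]) simp
  qed (use comp fU in auto)
  moreover have "simply_parabolic f U"
    unfolding f_def
    by (rule simply_parabolic_wave_map[OF a(1) \<open>open U\<close> \<open>connected U\<close>])
       (use U_drift fU quad in \<open>auto simp: f_def\<close>)
  moreover have "\<not> inj_on f U"
    using holomorphic_injective_imp_regular[OF hol \<open>open U\<close> _ crit_U] deriv_wave_map_critical_point
    by (auto simp: f_def)
  ultimately show ?thesis using hol by blast
qed

end
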